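(* Let $n\ge3$, let $\Omega\subset\mathbb{R}^n$ be a bounded open set, and let $u$ be a classical solution, defined on $[0,T)$, of $$u_t-\mathrm{div}(a(l_\varrho(u(t)))\nabla u)=f\ \text{ in }\Omega,\qquad u=0\ \text{ on }\partial\Omega,\qquad u(\cdot,0)=u_0\ \text{ in }\Omega .$$ Let $p>1$ and $q>1$ be such that $\frac1p+\frac1q=1$. Suppose that $U_q:=\sup_{t<T}|u(t)|_q<\infty$ and $f\in L^\infty(0,\infty;L^q(\Omega))$. If $p<\frac{n}{n-2}$, then $U_\infty:=\sup_{t<T}|u(t)|_\infty<\infty$.
   Context: $|\cdot|_s$ denotes the norm of $L^s(\Omega)$, $1\le s\le\infty$. The function $a:\mathbb{R}\to\mathbb{R}$ is continuous and there are constants $m,M$ with $0<m\le a(\epsilon)\le M$ for all $\epsilon\in\mathbb{R}$. The radius $\varrho\in[0,\mathrm{diam}(\Omega)]$ is fixed, $g\in L^2(\Omega)$, and $l_\varrho(u(t))(x)=\int_{\Omega\cap B(x,\varrho)}g(y)u(t,y)\,dy$, where $B(x,\varrho)$ is the closed ball of center $x$ and radius $\varrho$. *)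

theory Defs
  imports "HOL-Analysis.Analysis" "HOL-Probability.Essential_Supremum"
begin

text \<open>The norm of $L^s(\Omega)$, $1 \le s \le \infty$, with values in $[0,\infty]$: the value
  $\infty$ means that the (measurable) function is not in $L^s(\Omega)$. The case split inside the
  finite branch is only the $1/s$-th power on $[0,\infty]$, which the library has on the reals.\<close>

definition Lnorm :: "ennreal \<Rightarrow> 'a::euclidean_space set \<Rightarrow> ('a \<Rightarrow> real) \<Rightarrow> ennreal" where
  "Lnorm s \<Omega> v =
     (if s = \<infinity> then esssup (lebesgue_on \<Omega>) (\<lambda>x. ennreal \<bar>v x\<bar>)
      else (let I = (\<integral>\<^sup>+x. ennreal (\<bar>v x\<bar> powr enn2real s) \<partial>lebesgue_on \<Omega>)
            in if I = \<infinity> then \<infinity> else ennreal (enn2real I powr (1 / enn2real s))))"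

definition Lspace :: "ennreal \<Rightarrow> 'a::euclidean_space set \<Rightarrow> ('a \<Rightarrow> real) set" where
  "Lspace s \<Omega> = {v \<in> borel_measurable (lebesgue_on \<Omega>). Lnorm s \<Omega> v < \<infinity>}"

text \<open>The Bochner space $L^\infty(0,\infty;L^s(\Omega))$ in terms of representatives: values in
  $L^s(\Omega)$ for almost every time, strong measurability (almost everywhere limit, in the norm
  of $L^s(\Omega)$, of simple functions with values in $L^s(\Omega)$), and finite essential
  supremum of the norms.\<close>

definition Linf_Lspace ::
    "ennreal \<Rightarrow> 'a::euclidean_space set \<Rightarrow> (real \<Rightarrow> 'a \<Rightarrow> real) set" where
  "Linf_Lspace s \<Omega> =
     {f. (AE t in lebesgue_on {0<..}. f t \<in> Lspace s \<Omega>) \<and>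
         (\<exists>\<phi> :: nat \<Rightarrow> real \<Rightarrow> 'a \<Rightarrow> real.
            (\<forall>k. simple_function (lebesgue_on {0<..}) (\<phi> k) \<and> \<phi> k ` {0<..} \<subseteq> Lspace s \<Omega>) \<and>
            (AE t in lebesgue_on {0<..}.
               (\<lambda>k. Lnorm s \<Omega> (\<lambda>x. \<phi> k t x - f t x)) \<longlonglongrightarrow> 0)) \<and>
         esssup (lebesgue_on {0<..}) (\<lambda>t. Lnorm s \<Omega> (f t)) < \<infinity>}"

definition nonlocal :: "'a::euclidean_space set \<Rightarrow> real \<Rightarrow> ('a \<Rightarrow> real) \<Rightarrow> ('a \<Rightarrow> real) \<Rightarrow> 'a \<Rightarrow> real"
  where "nonlocal \<Omega> \<rho> g v x = (LINT y : \<Omega> \<inter> cball x \<rho> | lebesgue. g y * v y)"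

text \<open>Classical solutions on $[0,T)$, $0 < T \le \infty$: $u$ is continuous on
  $[0,T) \times \overline\Omega$, all derivatives occurring in the equation exist in the
  classical sense and are continuous on $(0,T) \times \Omega$, and the equation, the boundary
  condition and the initial condition hold pointwise. Since the diffusion coefficient is merely
  continuous, the spatial derivatives that occur are the gradient \<open>Du\<close> and the derivatives
  \<open>DF i\<close> in the \<open>i\<close>-th coordinate of the \<open>i\<close>-th component of the flux, whose sum is its
  divergence; the product rule is not available.\<close>

definition classical_solution ::
    "(real ^ 'n) set \<Rightarrow> ereal \<Rightarrow> (real \<Rightarrow> real) \<Rightarrow> real \<Rightarrow> (real ^ 'n \<Rightarrow> real) \<Rightarrow>
     (real \<Rightarrow> real ^ 'n \<Rightarrow> real) \<Rightarrow> (real ^ 'n \<Rightarrow> real) \<Rightarrow> (real \<Rightarrow> real ^ 'n \<Rightarrow> real) \<Rightarrow> bool"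
  where
  "classical_solution \<Omega> T a \<rho> g f u0 u \<longleftrightarrow>
     continuous_on ({t. 0 \<le> t \<and> ereal t < T} \<times> closure \<Omega>) (\<lambda>(t, x). u t x) \<and>
     (\<exists>(ut :: real \<Rightarrow> real ^ 'n \<Rightarrow> real) (Du :: real \<Rightarrow> real ^ 'n \<Rightarrow> real ^ 'n)
       (DF :: 'n \<Rightarrow> real \<Rightarrow> real ^ 'n \<Rightarrow> real).
        continuous_on ({t. 0 < t \<and> ereal t < T} \<times> \<Omega>) (\<lambda>(t, x). ut t x) \<and>
        continuous_on ({t. 0 < t \<and> ereal t < T} \<times> \<Omega>) (\<lambda>(t, x). Du t x) \<and>
        (\<forall>i. continuous_on ({t. 0 < t \<and> ereal t < T} \<times> \<Omega>) (\<lambda>(t, x). DF i t x)) \<and>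
        (\<forall>t x. 0 < t \<and> ereal t < T \<and> x \<in> \<Omega> \<longrightarrow>
           ((\<lambda>\<tau>. u \<tau> x) has_real_derivative ut t x) (at t) \<and>
           GDERIV (u t) x :> Du t x \<and>
           (\<forall>i. ((\<lambda>r. let y = x + axis i r in a (nonlocal \<Omega> \<rho> g (u t) y) * Du t y $ i)
                   has_real_derivative DF i t x) (at 0)) \<and>
           ut t x - (\<Sum>i\<in>UNIV. DF i t x) = f t x)) \<and>
     (\<forall>t x. 0 \<le> t \<and> ereal t < T \<and> x \<in> frontier \<Omega> \<longrightarrow> u t x = 0) \<and>
     (\<forall>x\<in>\<Omega>. u 0 x = u0 x)"

end

theory Submission
  imports Defs
begin

text \<open>Stampacchia truncation, applied to \<open>u\<close> and to \<open>-u\<close>. For a level \<open>k > 0\<close> above the initial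
  values let \<open>v = (u - k)\<^sup>+\<close>. Testing the equation with \<open>v\<^sup>3\<close> and using the Sobolev inequality for
  \<open>v\<^sup>2\<close> with an exponent \<open>s\<close> between \<open>2 p\<close> and \<open>2 n / (n - 2)\<close>, the energy \<open>\<integral> v\<^sup>4\<close> is
  nonincreasing in time whenever it exceeds a constant times \<open>\<mu>\<close> to the power \<open>1 + \<delta>\<close>, where
  \<open>\<delta> = 4 / p - 8 / s > 0\<close> and \<open>\<mu>\<close> bounds the measure of \<open>{u(t) > k}\<close> for all \<open>t\<close>. As the energy
  vanishes initially, this bounds it for all times, hence \<open>|{u(t) > h}| \<le> C \<mu> powr (1 + \<delta>) / (h - k)\<^sup>4\<close>
  for \<open>h > k\<close>, and iterating over increasing levels gives \<open>|{u(t) > k + d}| = 0\<close> uniformly in \<open>t\<close>.\<close>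

subsection \<open>Inequalities\<close>

text \<open>The powers 3 and 4 keep the argument classical. The positive part is only Lipschitz at
  its kink, but its square and higher powers are continuously differentiable, so no weak derivatives
  occur. With w = v^2 the energy is the integral of w^2, and D w = 2 v Du is continuous.

  Nothing is known about the boundary of the domain or about derivatives near it. Zero boundary
  values and a positive level make the zero extension of v vanish near every point outside the
  domain, so all integrals can be taken over the whole space and integration by parts has no
  boundary terms.

  The two ends of the range of s have different sources. The lower end s > 2 p is the positivity of
  \<open>\<delta>\<close>, without which the level iteration would not contract. The upper end s < 2
  n / (n - 2) is n (1/2 - 1/s) < 1, the integrability at 0 of the kernel in the Sobolev inequality.
  Being strictly subcritical and with supports in a fixed ball, that inequality follows from
  averaged line integrals. The hypothesis on p says exactly that this range is nonempty.\<close>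

lemma weighted_am_gm3:
  fixes x y z \<alpha> \<beta> \<gamma> :: real
  assumes "0 \<le> x" "0 \<le> y" "0 \<le> z" "0 < \<alpha>" "0 < \<beta>" "0 < \<gamma>" "\<alpha> + \<beta> + \<gamma> = 1"
  shows "x powr \<alpha> * y powr \<beta> * z powr \<gamma> \<le> \<alpha> * x + \<beta> * y + \<gamma> * z"
proof (cases "x = 0 \<or> y = 0 \<or> z = 0")
  case True
  then show ?thesis using assms by auto
next
  case False
  then have pos: "0 < x" "0 < y" "0 < z" using assms by auto
  define \<sigma> where "\<sigma> = \<alpha> + \<beta>"
  have \<sigma>: "0 < \<sigma>" "\<sigma> + \<gamma> = 1" using assms by (auto simp: \<sigma>_def)
  \<comment> \<open>The weighted geometric mean of \<open>x\<close> and \<open>y\<close> with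
    weights normalised to sum 1. Young's inequality for two factors is used once inside
    \<open>r\<close> and once for \<open>r\<close> against \<open>z\<close>.\<close>
  define r where "r = x powr (\<alpha> / \<sigma>) * y powr (\<beta> / \<sigma>)"
  have r: "0 < r" using pos by (simp add: r_def)
  have "\<alpha> / \<sigma> + \<beta> / \<sigma> = 1"
    using \<sigma> by (simp add: \<sigma>_def add_divide_distrib[symmetric])
  then have "r \<le> \<alpha> / \<sigma> * x + \<beta> / \<sigma> * y"
    unfolding r_def using pos assms \<sigma> by (intro Youngs_inequality_0) auto
  then have *: "\<sigma> * r \<le> \<alpha> * x + \<beta> * y"
    using \<sigma> by (simp add: field_simps)
  have "r powr \<sigma> = x powr \<alpha> * y powr \<beta>"
    using \<sigma> pos by (simp add: r_def powr_mult powr_powr)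
  then have "x powr \<alpha> * y powr \<beta> * z powr \<gamma> = r powr \<sigma> * z powr \<gamma>" by simp
  also have "\<dots> \<le> \<sigma> * r + \<gamma> * z"
    using r pos \<sigma> assms by (intro Youngs_inequality_0) auto
  finally show ?thesis using * by linarith
qed

text \<open>Dividing by \<open>a\<close>, \<open>b\<close>, \<open>c\<close> reduces to total masses
  at most 1, where the pointwise weighted AM-GM inequality can be integrated. Positive upper bounds
  in place of the integrals themselves make this division possible even when an integral
  vanishes.\<close>

lemma Holder_nn_integral3:
  fixes X Y Z :: "'b \<Rightarrow> real" and \<alpha> \<beta> \<gamma> a b c :: real
  assumes meas: "X \<in> borel_measurable N" "Y \<in> borel_measurable N" "Z \<in> borel_measurable N"
    and nonneg: "\<And>x. x \<in> space N \<Longrightarrow> 0 \<le> X x" "\<And>x. x \<in> space N \<Longrightarrow> 0 \<le> Y x"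
      "\<And>x. x \<in> space N \<Longrightarrow> 0 \<le> Z x"
    and exps: "0 < \<alpha>" "0 < \<beta>" "0 < \<gamma>" "\<alpha> + \<beta> + \<gamma> = 1"
    and pos: "0 < a" "0 < b" "0 < c"
    and bounds: "(\<integral>\<^sup>+x. ennreal (X x) \<partial>N) \<le> ennreal a" "(\<integral>\<^sup>+x. ennreal (Y x) \<partial>N) \<le> ennreal b"
      "(\<integral>\<^sup>+x. ennreal (Z x) \<partial>N) \<le> ennreal c"
  shows "(\<integral>\<^sup>+x. ennreal (X x powr \<alpha> * Y x powr \<beta> * Z x powr \<gamma>) \<partial>N)
    \<le> ennreal (a powr \<alpha> * b powr \<beta> * c powr \<gamma>)"
proof -
  note [measurable] = meas
  define C where "C = a powr \<alpha> * b powr \<beta> * c powr \<gamma>"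
  have C: "0 < C" using pos by (simp add: C_def)
  have pt: "X x powr \<alpha> * Y x powr \<beta> * Z x powr \<gamma>
      \<le> C * \<alpha> / a * X x + C * \<beta> / b * Y x + C * \<gamma> / c * Z x" if "x \<in> space N" for x
  proof -
    have "X x powr \<alpha> * Y x powr \<beta> * Z x powr \<gamma>
        = C * ((X x / a) powr \<alpha> * (Y x / b) powr \<beta> * (Z x / c) powr \<gamma>)"
      using pos nonneg[OF that] by (simp add: C_def powr_divide)
    also have "\<dots> \<le> C * (\<alpha> * (X x / a) + \<beta> * (Y x / b) + \<gamma> * (Z x / c))"
      using C pos nonneg[OF that] exps by (intro mult_left_mono weighted_am_gm3) auto
    finally show ?thesis by (simp add: algebra_simps)
  qed
  have "(\<integral>\<^sup>+x. ennreal (X x powr \<alpha> * Y x powr \<beta> * Z x powr \<gamma>) \<partial>N)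
      \<le> (\<integral>\<^sup>+x. ennreal (C * \<alpha> / a) * ennreal (X x) + ennreal (C * \<beta> / b) * ennreal (Y x)
          + ennreal (C * \<gamma> / c) * ennreal (Z x) \<partial>N)"
    using nonneg C pos exps pt
    by (intro nn_integral_mono) (simp flip: ennreal_mult ennreal_plus)
  also have "\<dots> = ennreal (C * \<alpha> / a) * (\<integral>\<^sup>+x. ennreal (X x) \<partial>N)
      + ennreal (C * \<beta> / b) * (\<integral>\<^sup>+x. ennreal (Y x) \<partial>N)
      + ennreal (C * \<gamma> / c) * (\<integral>\<^sup>+x. ennreal (Z x) \<partial>N)"
    by (simp add: nn_integral_add nn_integral_cmult)
  also have "\<dots> \<le> ennreal (C * \<alpha> / a) * ennreal a + ennreal (C * \<beta> / b) * ennreal b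
      + ennreal (C * \<gamma> / c) * ennreal c"
    by (intro add_mono mult_left_mono bounds) auto
  also have "\<dots> = ennreal (C * \<alpha> + C * \<beta> + C * \<gamma>)"
    using C pos exps by (simp flip: ennreal_mult ennreal_plus)
  also have "C * \<alpha> + C * \<beta> + C * \<gamma> = C"
    using exps(4) by (simp flip: distrib_left)
  finally show ?thesis by (simp add: C_def)
qed

text \<open>The sign of the derivative is asked for only above the barrier. After the last time
  \<open>s\<close> with \<open>y s \<le> c\<close> the function stays above \<open>c\<close>, hence
  is nonincreasing up to \<open>t\<close>, so \<open>y t\<close> cannot exceed
  \<open>y s\<close>.\<close>

lemma barrier:
  fixes y y' :: "real \<Rightarrow> real" and c b :: real
  assumes t: "0 \<le> t"
    and cont: "continuous_on {0..t} y"
    and init: "y 0 \<le> c"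
    and der: "\<And>r. 0 < r \<Longrightarrow> r < t \<Longrightarrow> (y has_real_derivative y' r) (at r)"
    and decr: "\<And>r. 0 < r \<Longrightarrow> r < t \<Longrightarrow> c < y r \<Longrightarrow> y' r \<le> 0"
  shows "y t \<le> c"
proof (rule ccontr)
  assume "\<not> y t \<le> c"
  define S where "S = {r \<in> {0..t}. y r \<le> c}"
  have "closed S" unfolding S_def
    by (intro continuous_closed_preimage_constant continuous_on_closed_Collect_le cont) auto
  moreover have ne: "0 \<in> S" using t init by (auto simp: S_def)
  moreover have bdd: "bdd_above S" by (auto simp: S_def)
  ultimately have sS: "Sup S \<in> S" using closed_contains_Sup[of S] by auto
  define s where "s = Sup S"
  have s: "0 \<le> s" "s < t" "y s \<le> c"
    using sS \<open>\<not> y t \<le> c\<close> by (auto simp: S_def s_def order_le_less)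
  have above: "c < y r" if "s < r" "r \<le> t" for r
    using cSup_upper[OF _ bdd, of r] that s by (fastforce simp: S_def s_def)
  have "y t \<le> y s"
  proof (rule DERIV_nonpos_imp_decreasing_open[of s t y])
    fix r assume "s < r" "r < t"
    then show "\<exists>d. (y has_real_derivative d) (at r) \<and> d \<le> 0"
      using der[of r] decr[of r] above[of r] s by auto
  qed (use s cont in \<open>auto intro: continuous_on_subset\<close>)
  then show False using s \<open>\<not> y t \<le> c\<close> by linarith
qed

text \<open>Halving the gaps between levels costs a factor 16 per step because of the fourth power;
  the superlinear exponent \<open>1 + \<delta>\<close> pays for it if the masses decay geometrically
  with a suitable ratio. All levels stay below \<open>k0 + d\<close>, so letting \<open>j\<close>
  grow shows that nothing is left above \<open>k0 + d\<close>.\<close>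

lemma Stampacchia_iteration:
  fixes \<Phi> :: "real \<Rightarrow> real \<Rightarrow> bool" and C \<delta> \<mu> k0 :: real
  assumes "0 < C" "0 < \<delta>" "0 < \<mu>"
    and start: "\<Phi> k0 \<mu>"
    and step: "\<And>k h \<mu>. k0 \<le> k \<Longrightarrow> k < h \<Longrightarrow> 0 < \<mu> \<Longrightarrow> \<Phi> k \<mu> \<Longrightarrow> \<Phi> h (C * \<mu> powr (1 + \<delta>) / (h - k) ^ 4)"
    and mono: "\<And>k \<mu> \<mu>'. \<Phi> k \<mu> \<Longrightarrow> \<mu> \<le> \<mu>' \<Longrightarrow> \<Phi> k \<mu>'"
  obtains d where "0 < d" "\<And>j::nat. \<exists>k\<in>{k0..k0 + d}. \<Phi> k (\<mu> * (2 powr (- 4 / \<delta>)) ^ j)"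
proof -
  \<comment> \<open>The ratio is chosen so that \<open>l powr \<delta> = 1 / 16\<close>, which
    exactly cancels the loss from halving the gap.\<close>
  define l where "l = 2 powr (- 4 / \<delta>)"
  have l: "0 < l" by (simp add: l_def)
  have l\<delta>: "l powr \<delta> = 1 / 16"
    using \<open>0 < \<delta>\<close> powr_minus_divide[of "2::real" 4] by (simp add: l_def powr_powr)
  \<comment> \<open>The induction step needs \<open>d ^ 4 * l\<close> to be at least
    \<open>16 * C * \<mu> powr \<delta>\<close>. The summand 1 gives \<open>d \<le> d ^ 4\<close>,
    so no fourth root has to be taken.\<close>
  define d where "d = 1 + 16 * C * \<mu> powr \<delta> / l"
  have d: "1 \<le> d" using assms l by (simp add: d_def)
  have "16 * C * \<mu> powr \<delta> / l \<le> d" by (simp add: d_def)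
  also have "d \<le> d ^ 4" using d by (intro self_le_power) auto
  finally have dC: "16 * C * \<mu> powr \<delta> \<le> d ^ 4 * l" using l by (simp add: field_simps)
  define K where "K j = k0 + d * (1 - (1 / 2) ^ j)" for j :: nat
  have "\<Phi> (K j) (\<mu> * l ^ j)" for j
  proof (induction j)
    case 0
    then show ?case using start by (simp add: K_def)
  next
    case (Suc j)
    have K: "k0 \<le> K j" "K j < K (Suc j)" "K (Suc j) - K j = d / 2 ^ Suc j"
      using d by (auto simp: K_def power_one_over field_simps)
    have "(l ^ j) powr \<delta> = (l powr \<delta>) ^ j"
      using l by (induction j) (auto simp: powr_mult)
    then have lj: "(\<mu> * l ^ j) powr (1 + \<delta>) = \<mu> * l ^ j * (\<mu> powr \<delta> / 16 ^ j)"
      using l \<open>0 < \<mu>\<close> by (simp add: powr_add powr_mult power_one_over l\<delta>)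
    have "C * (\<mu> * l ^ j) powr (1 + \<delta>) / (K (Suc j) - K j) ^ 4
        = C * \<mu> * l ^ j * \<mu> powr \<delta> / 16 ^ j * (2 ^ Suc j) ^ 4 / d ^ 4"
      by (simp add: lj K power_divide)
    also have "(2 ^ Suc j) ^ 4 = (16 * 16 ^ j :: real)"
      by (induction j) (auto simp: power_mult_distrib)
    also have "C * \<mu> * l ^ j * \<mu> powr \<delta> / 16 ^ j * (16 * 16 ^ j) / d ^ 4
        = \<mu> * l ^ j * (16 * C * \<mu> powr \<delta> / d ^ 4)" by simp
    also have "\<dots> \<le> \<mu> * l ^ j * l"
      using dC d \<open>0 < \<mu>\<close> l by (intro mult_left_mono) (auto simp: field_simps)
    finally show ?case
      using mono[OF step[OF K(1,2) _ Suc]] \<open>0 < \<mu>\<close> l by (simp add: algebra_simps)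
  qed
  moreover have "K j \<in> {k0..k0 + d}" for j
    using d power_le_one[of "1 / 2 :: real" j] by (simp add: K_def)
  ultimately have "\<exists>k\<in>{k0..k0 + d}. \<Phi> k (\<mu> * (2 powr (- 4 / \<delta>)) ^ j)" for j
    unfolding l_def by blast
  then show thesis using d by (intro that[of d]) auto
qed

subsection \<open>A Sobolev inequality\<close>

lemma nn_integral_lborel_affine:
  fixes f :: "'a::euclidean_space \<Rightarrow> ennreal" and c :: real and t :: 'a
  assumes [measurable]: "f \<in> borel_measurable borel" and c: "c \<noteq> 0"
  shows "(\<integral>\<^sup>+x. f x \<partial>lborel) = ennreal (\<bar>c\<bar> ^ DIM('a)) * (\<integral>\<^sup>+x. f (t + c *\<^sub>R x) \<partial>lborel)"
  by (subst lborel_affine[OF c, of t])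
     (simp add: nn_integral_density nn_integral_distr nn_integral_cmult)

text \<open>The fundamental theorem of calculus on the ray from \<open>x\<close> in direction
  \<open>z\<close>, whose far end is a zero of \<open>w\<close>. The bound is a nonnegative integral
  with an indicator so that it can later be averaged over \<open>z\<close> and the integrals
  interchanged.\<close>

lemma abs_le_nn_integral_gradient_line:
  fixes w :: "'a::euclidean_space \<Rightarrow> real" and Dw :: "'a \<Rightarrow> 'a"
  assumes der: "\<And>x. GDERIV w x :> Dw x" and cont: "continuous_on UNIV Dw"
    and H: "0 \<le> H" "w (x + H *\<^sub>R z) = 0" and D: "norm z \<le> D"
  shows "ennreal \<bar>w x\<bar> \<le> ennreal D * (\<integral>\<^sup>+r. ennreal (norm (Dw (x + r *\<^sub>R z))) * indicator {0..H} r \<partial>lborel)"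
proof -
  have D0: "0 \<le> D" using norm_ge_zero D by (rule order_trans)
  have cont': "continuous_on S (\<lambda>r. Dw (x + r *\<^sub>R z))" for S
    by (intro continuous_on_compose2[OF cont] continuous_intros) auto
  have vd: "((\<lambda>r. w (x + r *\<^sub>R z)) has_vector_derivative (z \<bullet> Dw (x + r *\<^sub>R z))) (at r within {0..H})" for r
  proof -
    have "((\<lambda>r. w (x + r *\<^sub>R z)) has_derivative (\<lambda>h. (h *\<^sub>R z) \<bullet> Dw (x + r *\<^sub>R z))) (at r within {0..H})"
      by (rule has_derivative_compose[where g = w, OF _ der[unfolded gderiv_def]])
         (auto intro!: derivative_eq_intros)
    then show ?thesis by (simp add: has_vector_derivative_def)
  qed
  have int: "((\<lambda>r. z \<bullet> Dw (x + r *\<^sub>R z)) has_integral (w (x + H *\<^sub>R z) - w (x + 0 *\<^sub>R z))) {0..H}"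
    by (intro fundamental_theorem_of_calculus vd H)
  have "(\<lambda>r. norm (Dw (x + r *\<^sub>R z))) integrable_on {0..H}"
    by (intro integrable_continuous_interval continuous_intros cont')
  then obtain L where L: "((\<lambda>r. norm (Dw (x + r *\<^sub>R z))) has_integral L) {0..H}"
    by (auto simp: integrable_on_def)
  have "norm (integral {0..H} (\<lambda>r. z \<bullet> Dw (x + r *\<^sub>R z)))
      \<le> integral {0..H} (\<lambda>r. D * norm (Dw (x + r *\<^sub>R z)))"
  proof (rule integral_norm_bound_integral)
    show "(\<lambda>r. z \<bullet> Dw (x + r *\<^sub>R z)) integrable_on {0..H}" using int by blast
    show "(\<lambda>r. D * norm (Dw (x + r *\<^sub>R z))) integrable_on {0..H}"
      by (intro integrable_continuous_interval continuous_intros cont')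
    fix r show "norm (z \<bullet> Dw (x + r *\<^sub>R z)) \<le> D * norm (Dw (x + r *\<^sub>R z))"
      using Cauchy_Schwarz_ineq2[of z "Dw (x + r *\<^sub>R z)"] D
      by (smt (verit) mult_right_mono norm_ge_zero real_norm_def)
  qed
  then have "\<bar>w x\<bar> \<le> D * L"
    using int L H by (simp add: integral_unique)
  then have "ennreal \<bar>w x\<bar> \<le> ennreal D * ennreal L"
    using D0 by (simp flip: ennreal_mult')
  also have "ennreal L = (\<integral>\<^sup>+r. ennreal (norm (Dw (x + r *\<^sub>R z))) * indicator {0..H} r \<partial>lborel)"
    by (rule nn_integral_has_integral_lebesgue'[OF _ L, symmetric]) auto
  finally show ?thesis .
qed

text \<open>By duality, the mean value over the box \<open>B\<close> at scale \<open>r\<close> maps \<open>L\<^sup>2\<close> into \<open>L\<^sup>s\<close> with a norm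
  that is integrable in \<open>r\<close> near \<open>0\<close> when \<open>n (1/2 - 1/s) < 1\<close>.\<close>

lemma box_average_pairing:
  fixes w :: "'a::euclidean_space \<Rightarrow> real" and G :: "'a \<Rightarrow> real" and B :: "'a set"
  assumes meas: "w \<in> borel_measurable borel" "G \<in> borel_measurable borel" "B \<in> sets borel"
    and G: "\<And>x. 0 \<le> G x" and B: "emeasure lborel B = 1"
    and s: "2 < s" and r: "0 < r" and I: "0 < I" and J: "0 < J"
    and wI: "(\<integral>\<^sup>+x. ennreal (\<bar>w x\<bar> powr s) \<partial>lborel) \<le> ennreal I"
    and GJ: "(\<integral>\<^sup>+x. ennreal ((G x)\<^sup>2) \<partial>lborel) \<le> ennreal J"
  shows "(\<integral>\<^sup>+x. \<integral>\<^sup>+z. ennreal (\<bar>w x\<bar> powr (s - 1) * G (x + r *\<^sub>R z)) * indicator B z \<partial>lborel \<partial>lborel)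
     \<le> ennreal (I powr (1 - 1 / s) * J powr (1 / 2) * r powr (- (DIM('a) * (1 / 2 - 1 / s))))"
proof -
  note [measurable] = meas
  define n where "n = DIM('a)"
  define b where "b = 1 / 2 - 1 / s"
  have b: "0 < b" "b < 1 / 2" using s by (auto simp: b_def field_simps)
  \<comment> \<open>The integrand is \<open>X\<close> to the power 1/2 times \<open>Y\<close> to the
    power \<open>b\<close> times \<open>Z\<close> to the power 1/s, and these exponents sum to 1.
    The integral of \<open>X\<close> is bounded by \<open>I\<close> because \<open>B\<close> has
    measure 1; that of \<open>Y\<close> by \<open>I * J / r ^ n\<close>, substituting in
    \<open>z\<close>; that of \<open>Z\<close> by \<open>J\<close>, translating in \<open>x\<close>.
    Only \<open>Y\<close> produces a power of \<open>r\<close>, and it enters with the small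
    exponent \<open>b\<close>.\<close>
  define X where "X = (\<lambda>(x, z). \<bar>w x\<bar> powr s * indicator B (z::'a) :: real)"
  define Y where "Y = (\<lambda>(x, z). \<bar>w x\<bar> powr s * (G (x + r *\<^sub>R z))\<^sup>2 * indicator B z)"
  define Z where "Z = (\<lambda>(x, z). (G (x + r *\<^sub>R z))\<^sup>2 * indicator B z)"
  have m: "X \<in> borel_measurable (lborel \<Otimes>\<^sub>M lborel)" "Y \<in> borel_measurable (lborel \<Otimes>\<^sub>M lborel)"
    "Z \<in> borel_measurable (lborel \<Otimes>\<^sub>M lborel)"
    by (simp_all add: X_def Y_def Z_def)
  have nonneg: "0 \<le> X q" "0 \<le> Y q" "0 \<le> Z q" for q
    by (auto simp: X_def Y_def Z_def split: prod.split)
  have "(\<integral>\<^sup>+q. ennreal (X q) \<partial>(lborel \<Otimes>\<^sub>M lborel))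
      = (\<integral>\<^sup>+x. \<integral>\<^sup>+z. ennreal (\<bar>w x\<bar> powr s) * indicator B z \<partial>lborel \<partial>lborel)"
    using m by (subst lborel.nn_integral_fst[symmetric])
      (auto simp: X_def ennreal_mult ennreal_indicator)
  also have "\<dots> \<le> ennreal I"
    using wI by (simp add: nn_integral_cmult B)
  finally have 1: "(\<integral>\<^sup>+q. ennreal (X q) \<partial>(lborel \<Otimes>\<^sub>M lborel)) \<le> ennreal I" .
  have scale: "(\<integral>\<^sup>+z. ennreal ((G (x + r *\<^sub>R z))\<^sup>2) \<partial>lborel) \<le> ennreal (J / r ^ n)" for x
  proof -
    let ?A = "\<integral>\<^sup>+z. ennreal ((G (x + r *\<^sub>R z))\<^sup>2) \<partial>lborel"
    have "ennreal (r ^ n) * ?A \<le> ennreal J"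
      using GJ r by (subst (asm) nn_integral_lborel_affine[where c = r and t = x]) (auto simp: n_def)
    then have "ennreal (1 / r ^ n) * (ennreal (r ^ n) * ?A) \<le> ennreal (1 / r ^ n) * ennreal J"
      by (rule mult_left_mono) simp
    then show ?thesis
      using r J by (simp add: mult.assoc[symmetric] flip: ennreal_mult)
  qed
  have "(\<integral>\<^sup>+q. ennreal (Y q) \<partial>(lborel \<Otimes>\<^sub>M lborel))
      = (\<integral>\<^sup>+x. \<integral>\<^sup>+z. ennreal (\<bar>w x\<bar> powr s) * (ennreal ((G (x + r *\<^sub>R z))\<^sup>2) * indicator B z) \<partial>lborel \<partial>lborel)"
    using m by (subst lborel.nn_integral_fst[symmetric])
      (auto simp: Y_def ennreal_mult ennreal_indicator mult.assoc)
  also have "\<dots> = (\<integral>\<^sup>+x. ennreal (\<bar>w x\<bar> powr s) * (\<integral>\<^sup>+z. ennreal ((G (x + r *\<^sub>R z))\<^sup>2) * indicator B z \<partial>lborel) \<partial>lborel)"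
    by (simp add: nn_integral_cmult)
  also have "\<dots> \<le> (\<integral>\<^sup>+x. ennreal (\<bar>w x\<bar> powr s) * ennreal (J / r ^ n) \<partial>lborel)"
  proof (intro nn_integral_mono mult_left_mono)
    fix x :: 'a
    have "(\<integral>\<^sup>+z. ennreal ((G (x + r *\<^sub>R z))\<^sup>2) * indicator B z \<partial>lborel)
        \<le> (\<integral>\<^sup>+z. ennreal ((G (x + r *\<^sub>R z))\<^sup>2) \<partial>lborel)"
      by (intro nn_integral_mono) (auto split: split_indicator)
    then show "(\<integral>\<^sup>+z. ennreal ((G (x + r *\<^sub>R z))\<^sup>2) * indicator B z \<partial>lborel) \<le> ennreal (J / r ^ n)"
      using scale[of x] by (rule order_trans)
  qed auto
  also have "\<dots> \<le> ennreal I * ennreal (J / r ^ n)"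
    using wI by (simp add: nn_integral_multc mult_right_mono)
  finally have 2: "(\<integral>\<^sup>+q. ennreal (Y q) \<partial>(lborel \<Otimes>\<^sub>M lborel)) \<le> ennreal (I * (J / r ^ n))"
    using I J r by (subst ennreal_mult) auto
  have "(\<integral>\<^sup>+q. ennreal (Z q) \<partial>(lborel \<Otimes>\<^sub>M lborel))
      = (\<integral>\<^sup>+z. \<integral>\<^sup>+x. ennreal ((G (x + r *\<^sub>R z))\<^sup>2) * indicator B z \<partial>lborel \<partial>lborel)"
    using m by (subst lborel_pair.nn_integral_snd[symmetric])
      (auto simp: Z_def ennreal_mult ennreal_indicator)
  also have "\<dots> = (\<integral>\<^sup>+z. (\<integral>\<^sup>+x. ennreal ((G x)\<^sup>2) \<partial>lborel) * indicator B z \<partial>lborel)"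
  proof (rule nn_integral_cong)
    fix z :: 'a
    show "(\<integral>\<^sup>+x. ennreal ((G (x + r *\<^sub>R z))\<^sup>2) * indicator B z \<partial>lborel)
        = (\<integral>\<^sup>+x. ennreal ((G x)\<^sup>2) \<partial>lborel) * indicator B z"
      by (subst (2) nn_integral_lborel_affine[where c = 1 and t = "r *\<^sub>R z"])
         (auto simp: nn_integral_multc add.commute)
  qed
  also have "\<dots> \<le> ennreal J"
    using GJ by (simp add: nn_integral_cmult B)
  finally have 3: "(\<integral>\<^sup>+q. ennreal (Z q) \<partial>(lborel \<Otimes>\<^sub>M lborel)) \<le> ennreal J" .
  have pt: "X (x, z) powr (1 / 2) * Y (x, z) powr b * Z (x, z) powr (1 / s)
      = \<bar>w x\<bar> powr (s - 1) * G (x + r *\<^sub>R z) * indicator B z" for x z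
  proof (cases "z \<in> B \<and> w x \<noteq> 0 \<and> G (x + r *\<^sub>R z) \<noteq> 0")
    case True
    let ?g = "G (x + r *\<^sub>R z)"
    have g: "0 < ?g" using G[of "x + r *\<^sub>R z"] True by simp
    have e: "s * (1 / 2) + s * b = s - 1" "2 * b + 2 * (1 / s) = 1"
      using s by (auto simp: b_def field_simps)
    have "X (x, z) powr (1 / 2) * Y (x, z) powr b * Z (x, z) powr (1 / s)
       = (\<bar>w x\<bar> powr (s * (1 / 2)) * \<bar>w x\<bar> powr (s * b)) * (?g powr (2 * b) * ?g powr (2 * (1 / s)))"
      using True g by (simp add: X_def Y_def Z_def powr_mult powr_powr powr_numeral[symmetric] del: powr_numeral)
    also have "\<dots> = \<bar>w x\<bar> powr (s - 1) * ?g"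
      using True g by (simp only: powr_add[symmetric] e) simp
    finally show ?thesis using True by simp
  next
    case False
    then show ?thesis using s by (auto simp: X_def Y_def Z_def)
  qed
  have "(\<integral>\<^sup>+x. \<integral>\<^sup>+z. ennreal (\<bar>w x\<bar> powr (s - 1) * G (x + r *\<^sub>R z)) * indicator B z \<partial>lborel \<partial>lborel)
      = (\<integral>\<^sup>+x. \<integral>\<^sup>+z. ennreal (X (x, z) powr (1 / 2) * Y (x, z) powr b * Z (x, z) powr (1 / s)) \<partial>lborel \<partial>lborel)"
    by (simp add: pt ennreal_mult'' ennreal_indicator)
  also have "\<dots> = (\<integral>\<^sup>+q. ennreal (X q powr (1 / 2) * Y q powr b * Z q powr (1 / s)) \<partial>(lborel \<Otimes>\<^sub>M lborel))"
    using m by (subst lborel.nn_integral_fst[symmetric]) auto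
  also have "\<dots> \<le> ennreal (I powr (1 / 2) * (I * (J / r ^ n)) powr b * J powr (1 / s))"
    using I J r b s nonneg by (intro Holder_nn_integral3[OF m] 1 2 3) (auto simp: b_def)
  also have "(I * (J / r ^ n)) powr b = I powr b * J powr b * r powr (- (n * b))"
    using I J r by (simp add: powr_mult powr_divide powr_minus_divide powr_powr powr_realpow[symmetric])
  also have "I powr (1 / 2) * (I powr b * J powr b * r powr (- (n * b))) * J powr (1 / s)
      = I powr (1 / 2 + b) * J powr (b + 1 / s) * r powr (- (n * b))"
    by (simp add: powr_add)
  also have "1 / 2 + b = 1 - 1 / s" by (simp add: b_def)
  also have "b + 1 / s = 1 / 2" by (simp add: b_def)
  finally show ?thesis by (simp add: n_def b_def)
qed

lemma nn_integral_powr_Icc0: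
  fixes \<kappa> H :: real
  assumes "\<kappa> < 1" "0 \<le> H"
  shows "(\<integral>\<^sup>+r. ennreal (r powr (- \<kappa>)) * indicator {0..H} r \<partial>lborel) = ennreal (H powr (1 - \<kappa>) / (1 - \<kappa>))"
  using nn_integral_has_integral_lebesgue'[OF _ has_integral_powr_from_0[of "- \<kappa>" H]] assms
  by (simp add: algebra_simps)

text \<open>Since \<open>w\<close> vanishes at \<open>x + H z\<close> for every \<open>z \<in> B\<close>, averaging the line integrals of the
  gradient over \<open>B\<close> takes the place of the Riesz potential.\<close>

lemma Sobolev_aux:
  fixes w :: "'a::euclidean_space \<Rightarrow> real" and Dw :: "'a \<Rightarrow> 'a" and B :: "'a set"
  assumes der: "\<And>x. GDERIV w x :> Dw x" and cont: "continuous_on UNIV Dw"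
    and s: "2 < s" and \<kappa>: "DIM('a) * (1 / 2 - 1 / s) < 1"
    and H: "0 \<le> H" "\<And>x z. w x \<noteq> 0 \<Longrightarrow> z \<in> B \<Longrightarrow> w (x + H *\<^sub>R z) = 0"
    and B: "B \<in> sets borel" "emeasure lborel B = 1" "\<And>z. z \<in> B \<Longrightarrow> norm z \<le> D"
    and D: "0 \<le> D"
    and I: "0 < I" "(\<integral>\<^sup>+x. ennreal (\<bar>w x\<bar> powr s) \<partial>lborel) = ennreal I"
    and J: "0 < J" "(\<integral>\<^sup>+x. ennreal ((norm (Dw x))\<^sup>2) \<partial>lborel) \<le> ennreal J"
    and L: "L = H powr (1 - DIM('a) * (1 / 2 - 1 / s)) / (1 - DIM('a) * (1 / 2 - 1 / s))"
  shows "I \<le> ((D * L)\<^sup>2 * J) powr (s / 2)"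
proof -
  have "continuous_on UNIV w"
    using der by (intro has_derivative_continuous_on) (auto simp: gderiv_def intro: has_derivative_at_withinI)
  then have w[measurable]: "w \<in> borel_measurable borel"
    by (rule borel_measurable_continuous_onI)
  have Dw[measurable]: "Dw \<in> borel_measurable borel"
    using cont by (rule borel_measurable_continuous_onI)
  note [measurable] = B(1)
  define b where "b = 1 / 2 - 1 / s"
  define \<kappa>' where "\<kappa>' = DIM('a) * b"
  define G where "G = (\<lambda>x. norm (Dw x))"
  have [measurable]: "G \<in> borel_measurable borel" by (simp add: G_def)
  define C where "C = I powr (1 - 1 / s) * J powr (1 / 2)"
  have C: "0 < C" using I J by (simp add: C_def)
  have L0: "0 \<le> L" using \<kappa> by (simp add: L)
  \<comment> \<open>The duality step: the line integral bound is multiplied by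
    \<open>\<bar>w x\<bar> powr (s - 1)\<close>, so that integrating the left side over
    \<open>x\<close> returns \<open>I\<close> itself.\<close>
  have pt: "ennreal (\<bar>w x\<bar> powr s) \<le> ennreal D * (\<integral>\<^sup>+r. indicator {0..H} r *
      (\<integral>\<^sup>+z. ennreal (\<bar>w x\<bar> powr (s - 1) * G (x + r *\<^sub>R z)) * indicator B z \<partial>lborel) \<partial>lborel)" for x
  proof (cases "w x = 0")
    case True
    then show ?thesis by simp
  next
    case False
    \<comment> \<open>As \<open>B\<close> has measure 1, a number equals its average over
      \<open>B\<close>; the line integral bound is then inserted separately for each direction
      \<open>z\<close>.\<close>
    have "ennreal \<bar>w x\<bar> = (\<integral>\<^sup>+z. ennreal \<bar>w x\<bar> * indicator B z \<partial>lborel)"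
      by (simp add: nn_integral_cmult B)
    also have "\<dots> \<le> (\<integral>\<^sup>+z. (ennreal D * (\<integral>\<^sup>+r. ennreal (G (x + r *\<^sub>R z)) * indicator {0..H} r \<partial>lborel)) * indicator B z \<partial>lborel)"
    proof (rule nn_integral_mono)
      fix z
      show "ennreal \<bar>w x\<bar> * indicator B z \<le> (ennreal D * (\<integral>\<^sup>+r. ennreal (G (x + r *\<^sub>R z)) * indicator {0..H} r \<partial>lborel)) * indicator B z"
        using abs_le_nn_integral_gradient_line[OF der cont H(1) H(2)[OF False] B(3)]
        by (cases "z \<in> B") (auto simp: G_def)
    qed
    also have "\<dots> = ennreal D * (\<integral>\<^sup>+z. \<integral>\<^sup>+r. ennreal (G (x + r *\<^sub>R z)) * indicator {0..H} r * indicator B z \<partial>lborel \<partial>lborel)"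
      by (simp add: nn_integral_cmult nn_integral_multc mult.assoc[of "ennreal D"])
    also have "(\<integral>\<^sup>+z. \<integral>\<^sup>+r. ennreal (G (x + r *\<^sub>R z)) * indicator {0..H} r * indicator B z \<partial>lborel \<partial>lborel)
       = (\<integral>\<^sup>+r. \<integral>\<^sup>+z. ennreal (G (x + r *\<^sub>R z)) * indicator {0..H} r * indicator B z \<partial>lborel \<partial>lborel)"
      by (rule lborel_pair.Fubini') simp
    finally have *: "ennreal \<bar>w x\<bar> \<le> ennreal D * (\<integral>\<^sup>+r. \<integral>\<^sup>+z. ennreal (G (x + r *\<^sub>R z)) * indicator {0..H} r * indicator B z \<partial>lborel \<partial>lborel)" .
    have "ennreal (\<bar>w x\<bar> powr s) = ennreal (\<bar>w x\<bar> powr (s - 1)) * ennreal \<bar>w x\<bar>"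
      using False by (simp flip: ennreal_mult add: powr_diff)
    also have "\<dots> \<le> ennreal (\<bar>w x\<bar> powr (s - 1)) * (ennreal D * (\<integral>\<^sup>+r. \<integral>\<^sup>+z. ennreal (G (x + r *\<^sub>R z)) * indicator {0..H} r * indicator B z \<partial>lborel \<partial>lborel))"
      by (intro mult_left_mono *) auto
    also have "\<dots> = ennreal D * (\<integral>\<^sup>+r. \<integral>\<^sup>+z. ennreal (\<bar>w x\<bar> powr (s - 1)) * (ennreal (G (x + r *\<^sub>R z)) * indicator {0..H} r * indicator B z) \<partial>lborel \<partial>lborel)"
      by (simp add: nn_integral_cmult mult.left_commute)
    also have "(\<integral>\<^sup>+r. \<integral>\<^sup>+z. ennreal (\<bar>w x\<bar> powr (s - 1)) * (ennreal (G (x + r *\<^sub>R z)) * indicator {0..H} r * indicator B z) \<partial>lborel \<partial>lborel)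
      = (\<integral>\<^sup>+r. \<integral>\<^sup>+z. indicator {0..H} r * (ennreal (\<bar>w x\<bar> powr (s - 1) * G (x + r *\<^sub>R z)) * indicator B z) \<partial>lborel \<partial>lborel)"
      by (simp add: ennreal_mult G_def mult_ac)
    finally show ?thesis by (simp add: nn_integral_cmult)
  qed
  have "ennreal I \<le> (\<integral>\<^sup>+x. ennreal D * (\<integral>\<^sup>+r. indicator {0..H} r *
      (\<integral>\<^sup>+z. ennreal (\<bar>w x\<bar> powr (s - 1) * G (x + r *\<^sub>R z)) * indicator B z \<partial>lborel) \<partial>lborel) \<partial>lborel)"
    unfolding I(2)[symmetric] by (intro nn_integral_mono pt)
  also have "\<dots> = ennreal D * (\<integral>\<^sup>+x. \<integral>\<^sup>+r. indicator {0..H} r *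
      (\<integral>\<^sup>+z. ennreal (\<bar>w x\<bar> powr (s - 1) * G (x + r *\<^sub>R z)) * indicator B z \<partial>lborel) \<partial>lborel \<partial>lborel)"
    by (simp add: nn_integral_cmult)
  also have "(\<integral>\<^sup>+x. \<integral>\<^sup>+r. indicator {0..H} r *
      (\<integral>\<^sup>+z. ennreal (\<bar>w x\<bar> powr (s - 1) * G (x + r *\<^sub>R z)) * indicator B z \<partial>lborel) \<partial>lborel \<partial>lborel)
    = (\<integral>\<^sup>+r. \<integral>\<^sup>+x. indicator {0..H} r *
      (\<integral>\<^sup>+z. ennreal (\<bar>w x\<bar> powr (s - 1) * G (x + r *\<^sub>R z)) * indicator B z \<partial>lborel) \<partial>lborel \<partial>lborel)"
    by (rule lborel_pair.Fubini') simp
  also have "\<dots> \<le> (\<integral>\<^sup>+r. ennreal C * (ennreal (r powr (- \<kappa>')) * indicator {0..H} r) \<partial>lborel)"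
  proof (rule nn_integral_mono_AE)
    show "AE r in lborel. (\<integral>\<^sup>+x. indicator {0..H} r *
      (\<integral>\<^sup>+z. ennreal (\<bar>w x\<bar> powr (s - 1) * G (x + r *\<^sub>R z)) * indicator B z \<partial>lborel) \<partial>lborel)
      \<le> ennreal C * (ennreal (r powr (- \<kappa>')) * indicator {0..H} r)"
      using AE_lborel_singleton[of "0::real"]
    proof (rule AE_mp, intro AE_I2 impI)
      fix r :: real assume "r \<noteq> 0"
      show "(\<integral>\<^sup>+x. indicator {0..H} r *
      (\<integral>\<^sup>+z. ennreal (\<bar>w x\<bar> powr (s - 1) * G (x + r *\<^sub>R z)) * indicator B z \<partial>lborel) \<partial>lborel)
      \<le> ennreal C * (ennreal (r powr (- \<kappa>')) * indicator {0..H} r)"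
      proof (cases "r \<in> {0..H}")
        case True
        then have r: "0 < r" using \<open>r \<noteq> 0\<close> by simp
        have "(\<integral>\<^sup>+x. \<integral>\<^sup>+z. ennreal (\<bar>w x\<bar> powr (s - 1) * G (x + r *\<^sub>R z)) * indicator B z \<partial>lborel \<partial>lborel)
          \<le> ennreal (C * r powr (- \<kappa>'))"
          unfolding C_def \<kappa>'_def b_def
          by (rule box_average_pairing) (use I J B s r in \<open>auto simp: G_def\<close>)
        then show ?thesis using True C by (simp add: ennreal_mult)
      qed simp
    qed
  qed
  also have "\<dots> = ennreal C * ennreal L"
    using nn_integral_powr_Icc0[of \<kappa>' H] \<kappa> H by (simp add: nn_integral_cmult L \<kappa>'_def b_def)
  finally have "ennreal I \<le> ennreal (D * (C * L))"
    using D C L0 by (simp add: ennreal_mult mult_left_mono)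
  then have "I \<le> D * (C * L)"
    using D C L0 by (simp add: ennreal_le_iff)
  also have "D * (C * L) = I powr (1 - 1 / s) * (D * L * J powr (1 / 2))"
    by (simp add: C_def)
  finally have "I powr (1 - 1 / s) * I powr (1 / s) \<le> I powr (1 - 1 / s) * (D * L * J powr (1 / 2))"
    using I by (simp flip: powr_add)
  \<comment> \<open>The common factor can be cancelled since \<open>I\<close> is positive and
    finite; a power 1/s of \<open>I\<close> remains on the left.\<close>
  then have le: "I powr (1 / s) \<le> D * L * J powr (1 / 2)"
    using I by (simp add: mult_le_cancel_left)
  have "I = (I powr (1 / s)) powr s" using s I by (simp add: powr_powr)
  also have "\<dots> \<le> (D * L * J powr (1 / 2)) powr s"
    using le s by (intro powr_mono2) auto
  also have "D * L * J powr (1 / 2) = ((D * L)\<^sup>2 * J) powr (1 / 2)"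
    using D L0 J by (simp add: powr_mult powr_half_sqrt)
  also have "(((D * L)\<^sup>2 * J) powr (1 / 2)) powr s = ((D * L)\<^sup>2 * J) powr (s / 2)"
    by (simp add: powr_powr)
  finally show ?thesis .
qed

text \<open>The condition on \<open>s\<close> makes \<open>r\<close> to the power
  \<open>- DIM('a) * (1 / 2 - 1 / s)\<close> integrable near 0. Line integrals of a length fixed by
  \<open>R\<close> then suffice, and \<open>K\<close> depends on \<open>R\<close>, \<open>s\<close>
  and the dimension but not on \<open>w\<close>. The existential over \<open>I\<close> also records
  that the integral is finite.\<close>

lemma Sobolev:
  fixes s R :: real
  assumes s: "2 < s" "DIM('a::euclidean_space) * (1 / 2 - 1 / s) < 1" and R: "0 \<le> R"
  obtains K where "0 < K"
    "\<And>(w :: 'a \<Rightarrow> real) Dw J. (\<And>x. GDERIV w x :> Dw x) \<Longrightarrow> continuous_on UNIV Dw \<Longrightarrow>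
       (\<And>x. R < norm x \<Longrightarrow> w x = 0) \<Longrightarrow> 0 \<le> J \<Longrightarrow>
       (\<integral>\<^sup>+x. ennreal ((norm (Dw x))\<^sup>2) \<partial>lborel) \<le> ennreal J \<Longrightarrow>
       \<exists>I. 0 \<le> I \<and> (\<integral>\<^sup>+x. ennreal (\<bar>w x\<bar> powr s) \<partial>lborel) = ennreal I \<and> I powr (2 / s) \<le> K * J"
proof -
  \<comment> \<open>A box of volume 1 that stays away from the origin: every direction in it has
    norm at least 1, so all rays leave the support after a common time.\<close>
  define B where "B = cbox One (2 *\<^sub>R (One :: 'a))"
  have Bm: "B \<in> sets borel" "emeasure lborel B = 1"
    unfolding B_def by (auto simp: emeasure_lborel_cbox_eq algebra_simps)
  have "bounded B" by (simp add: B_def bounded_cbox)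
  then obtain D where D: "0 < D" "\<And>z. z \<in> B \<Longrightarrow> norm z \<le> D"
    by (auto simp: bounded_pos)
  have B1: "1 \<le> norm z" if "z \<in> B" for z
  proof -
    obtain i :: 'a where i: "i \<in> Basis" using nonempty_Basis by blast
    then have "1 \<le> z \<bullet> i" using that by (auto simp: B_def mem_box)
    then show ?thesis using Basis_le_norm[OF i, of z] by linarith
  qed
  \<comment> \<open>If \<open>norm x \<le> R\<close> and \<open>norm z \<ge> 1\<close>, then
    \<open>x + H *\<^sub>R z\<close> has norm at least \<open>H - R = R + 1\<close>, outside the
    support.\<close>
  define H where "H = 2 * R + 1"
  define L where "L = H powr (1 - DIM('a) * (1 / 2 - 1 / s)) / (1 - DIM('a) * (1 / 2 - 1 / s))"
  have L: "0 < L" using s R by (simp add: L_def H_def)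
  define K where "K = (D * L)\<^sup>2"
  have K: "0 < K" using D L by (simp add: K_def)
  show thesis
  proof (rule that[OF K])
    fix w :: "'a \<Rightarrow> real" and Dw J
    assume der: "\<And>x. GDERIV w x :> Dw x" and cont: "continuous_on UNIV Dw"
      and supp: "\<And>x. R < norm x \<Longrightarrow> w x = 0" and J: "0 \<le> (J::real)"
      and DJ: "(\<integral>\<^sup>+x. ennreal ((norm (Dw x))\<^sup>2) \<partial>lborel) \<le> ennreal J"
    have wc: "continuous_on UNIV w"
      using der by (intro has_derivative_continuous_on) (auto simp: gderiv_def intro: has_derivative_at_withinI)
    define I where "I = integral\<^sup>L lborel (\<lambda>x. \<bar>w x\<bar> powr s)"
    have "integrable lborel (\<lambda>x. indicator (cball 0 R) x *\<^sub>R \<bar>w x\<bar> powr s)"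
      using s by (intro borel_integrable_compact continuous_on_powr' continuous_intros continuous_on_subset[OF wc]) auto
    also have "(\<lambda>x. indicator (cball 0 R) x *\<^sub>R \<bar>w x\<bar> powr s) = (\<lambda>x. \<bar>w x\<bar> powr s)"
      using supp by (force simp: indicator_def)
    finally have int: "integrable lborel (\<lambda>x. \<bar>w x\<bar> powr s)" .
    have I: "0 \<le> I" "(\<integral>\<^sup>+x. ennreal (\<bar>w x\<bar> powr s) \<partial>lborel) = ennreal I"
      using nn_integral_eq_integral[OF int] by (auto simp: I_def)
    have exit: "w (x + H *\<^sub>R z) = 0" if "w x \<noteq> 0" "z \<in> B" for x z
    proof (rule supp)
      have "norm x \<le> R" using supp that by force
      moreover have "H \<le> norm (H *\<^sub>R z)"
        using B1[OF that(2)] R by (simp add: H_def mult_le_cancel_left1)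
      moreover have "norm (H *\<^sub>R z) \<le> norm (x + H *\<^sub>R z) + norm x"
        using norm_triangle_ineq4[of "x + H *\<^sub>R z" x] by simp
      ultimately show "R < norm (x + H *\<^sub>R z)" using R H_def by linarith
    qed
    have "I powr (2 / s) \<le> K * J"
    proof (cases "I = 0")
      case True
      then show ?thesis using K J by simp
    next
      case False
      \<comment> \<open>The duality argument is available for positive gradient bounds; enlarging
        \<open>J\<close> by \<open>e\<close> and letting \<open>e\<close> tend to 0 covers
        \<open>J = 0\<close> as well.\<close>
      have eps: "I powr (2 / s) \<le> K * (J + e)" if "0 < e" for e
      proof -
        have "(\<integral>\<^sup>+x. ennreal ((norm (Dw x))\<^sup>2) \<partial>lborel) \<le> ennreal (J + e)"
          using DJ by (rule order_trans) (use that J in \<open>auto intro: ennreal_leI\<close>)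
        then have "I \<le> (K * (J + e)) powr (s / 2)"
          unfolding K_def
          by (intro Sobolev_aux[OF der cont s _ exit Bm D(2) _ _ I(2) _ _ L_def])
             (use False I J D R that in \<open>auto simp: H_def\<close>)
        then have "I powr (2 / s) \<le> ((K * (J + e)) powr (s / 2)) powr (2 / s)"
          using I s by (intro powr_mono2) auto
        also have "\<dots> = K * (J + e)" using s K J that by (simp add: powr_powr)
        finally show ?thesis .
      qed
      have "I powr (2 / s) \<le> K * J + e" if "0 < e" for e
        using eps[of "e / K"] that K by (simp add: distrib_left)
      then show ?thesis by (rule field_le_epsilon)
    qed
    then show "\<exists>I. 0 \<le> I \<and> (\<integral>\<^sup>+x. ennreal (\<bar>w x\<bar> powr s) \<partial>lborel) = ennreal I \<and> I powr (2 / s) \<le> K * J"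
      using I by blast
  qed
qed

subsection \<open>Integrals of functions with bounded support\<close>

text \<open>Writing the exponent as \<open>j + 2\<close> leaves a power of at least 1 in the
  derivative. At the kink, \<open>max 0 (z - k) ^ (j + 1)\<close> is a continuous slope function in
  the sense of Caratheodory and vanishes there.\<close>

lemma has_real_derivative_pos_part_power:
  fixes k y :: real
  shows "((\<lambda>y. max 0 (y - k) ^ (j + 2)) has_real_derivative real (j + 2) * max 0 (y - k) ^ (j + 1)) (at y)"
proof -
  consider "y < k" | "k < y" | "y = k" by linarith
  then show ?thesis
  proof cases
    case 1
    then have "((\<lambda>y. 0) has_real_derivative real (j + 2) * max 0 (y - k) ^ (j + 1)) (at y)" by simp
    then show ?thesis
      by (rule has_field_derivative_transform_within_open[where S = "{..<k}"]) (use 1 in auto)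
  next
    case 2
    have "((\<lambda>y. y - k) has_real_derivative 1) (at y)"
      by (auto intro!: derivative_eq_intros)
    from DERIV_power[OF this, of "j + 2"]
    have "((\<lambda>y. (y - k) ^ (j + 2)) has_real_derivative real (j + 2) * max 0 (y - k) ^ (j + 1)) (at y)"
      using 2 by simp
    then show ?thesis
      by (rule has_field_derivative_transform_within_open[where S = "{k<..}"]) (use 2 in auto)
  next
    case 3
    have "\<forall>z. max 0 (z - k) ^ (j + 2) - max 0 (y - k) ^ (j + 2) = max 0 (z - k) ^ (j + 1) * (z - y)"
      by (auto simp: 3 max_def)
    moreover have "isCont (\<lambda>z. max 0 (z - k) ^ (j + 1)) y" by (intro continuous_intros)
    ultimately show ?thesis
      unfolding CARAT_DERIV by (intro exI[of _ "\<lambda>z. max 0 (z - k) ^ (j + 1)"]) (simp add: 3)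
  qed
qed

lemma bounded_support_integrable:
  fixes h :: "'a::euclidean_space \<Rightarrow> real"
  assumes "continuous_on UNIV h" and supp: "\<And>x. R < norm x \<Longrightarrow> h x = 0"
  shows "integrable lborel h"
proof -
  have "integrable lborel (\<lambda>x. indicator (cball 0 R) x *\<^sub>R h x)"
    using assms by (intro borel_integrable_compact continuous_on_subset[OF assms(1)]) auto
  also have "(\<lambda>x. indicator (cball 0 R) x *\<^sub>R h x) = h"
    using supp by (force simp: indicator_def)
  finally show ?thesis .
qed

text \<open>Passes between integrals over a box, for which continuity in a parameter and the Leibniz
  rule are applied, and Lebesgue integrals over the whole space, which are translation
  invariant.\<close>

lemma bounded_support_integral:
  fixes h :: "'a::euclidean_space \<Rightarrow> real"
  assumes "continuous_on UNIV h" and supp: "\<And>x. R < norm x \<Longrightarrow> h x = 0"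
    and Q: "cball 0 R \<subseteq> cbox a b"
  shows "integral (cbox a b) h = integral\<^sup>L lborel h"
proof -
  have "integral (cbox a b) h = integral UNIV (\<lambda>x. if x \<in> cbox a b then h x else 0)"
    by (simp add: integral_restrict_UNIV)
  also have "(\<lambda>x. if x \<in> cbox a b then h x else 0) = h"
    using supp Q by (force simp: fun_eq_iff)
  finally show ?thesis
    using integral_lborel[OF bounded_support_integrable[OF assms(1,2)]] by simp
qed

lemma cball_subset_some_cbox:
  fixes R :: real
  obtains a b :: "'a::euclidean_space" where "cball 0 R \<subseteq> cbox a b"
  using bounded_subset_cbox_symmetric[OF bounded_cball] by blast

lemma continuous_on_slice:
  assumes "continuous_on (S \<times> A) (\<lambda>(t, x). h t x)" "t \<in> S"
  shows "continuous_on A (h t)"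
proof -
  have "continuous_on A (\<lambda>x. (t, x))" by (intro continuous_intros)
  from continuous_on_compose2[OF assms(1) this] show ?thesis using assms(2) by auto
qed

lemma continuous_on_lborel_integral_param:
  fixes h :: "real \<Rightarrow> 'a::euclidean_space \<Rightarrow> real"
  assumes "continuous_on (S \<times> UNIV) (\<lambda>(t, x). h t x)"
    and supp: "\<And>t x. t \<in> S \<Longrightarrow> R < norm x \<Longrightarrow> h t x = 0"
  shows "continuous_on S (\<lambda>t. integral\<^sup>L lborel (h t))"
proof -
  obtain a b :: 'a where Q: "cball 0 R \<subseteq> cbox a b" by (rule cball_subset_some_cbox)
  have "continuous_on S (\<lambda>t. integral (cbox a b) (h t))"
    by (intro integral_continuous_on_param continuous_on_subset[OF assms(1)]) auto
  moreover have "integral (cbox a b) (h t) = integral\<^sup>L lborel (h t)" if "t \<in> S" for t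
    using bounded_support_integral[OF continuous_on_slice[OF assms(1) that] supp[OF that] Q] .
  ultimately show ?thesis by (rule continuous_on_eq)
qed

lemma has_real_derivative_lborel_integral:
  fixes h dh :: "real \<Rightarrow> 'a::euclidean_space \<Rightarrow> real"
  assumes U: "open U" "convex U" "t \<in> U"
    and der: "\<And>t x. t \<in> U \<Longrightarrow> ((\<lambda>\<tau>. h \<tau> x) has_real_derivative dh t x) (at t)"
    and cont: "\<And>t. t \<in> U \<Longrightarrow> continuous_on UNIV (h t)"
      "continuous_on (U \<times> UNIV) (\<lambda>(t, x). dh t x)"
    and supp: "\<And>t x. t \<in> U \<Longrightarrow> R < norm x \<Longrightarrow> h t x = 0"
      "\<And>t x. t \<in> U \<Longrightarrow> R < norm x \<Longrightarrow> dh t x = 0"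
  shows "((\<lambda>t. integral\<^sup>L lborel (h t)) has_real_derivative integral\<^sup>L lborel (dh t)) (at t)"
proof -
  obtain a b :: 'a where Q: "cball 0 R \<subseteq> cbox a b" by (rule cball_subset_some_cbox)
  have "((\<lambda>t. integral (cbox a b) (h t)) has_real_derivative integral (cbox a b) (dh t)) (at t within U)"
  proof (rule leibniz_rule_field_derivative)
    show "((\<lambda>\<tau>. h \<tau> x) has_real_derivative dh s x) (at s within U)" if "s \<in> U" for s x
      using der[OF that] by (rule has_field_derivative_at_within)
    show "h s integrable_on cbox a b" if "s \<in> U" for s
      by (intro integrable_continuous continuous_on_subset[OF cont(1)[OF that]]) auto
    show "continuous_on (U \<times> cbox a b) (\<lambda>(t, x). dh t x)"
      by (rule continuous_on_subset[OF cont(2)]) auto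
  qed (use U in auto)
  then have "((\<lambda>t. integral (cbox a b) (h t)) has_real_derivative integral\<^sup>L lborel (dh t)) (at t)"
    using bounded_support_integral[OF continuous_on_slice[OF cont(2) U(3)] supp(2)[OF U(3)] Q] U
    by (simp only: at_within_open)
  moreover have "integral (cbox a b) (h s) = integral\<^sup>L lborel (h s)" if "s \<in> U" for s
    using bounded_support_integral[OF cont(1)[OF that] supp(1)[OF that] Q] .
  ultimately show ?thesis
    by (rule has_field_derivative_transform_within_open[OF _ U(1,3)])
qed

text \<open>By translation invariance the integral of \<open>P (x + r *\<^sub>R e)\<close> does not
  depend on \<open>r\<close>; differentiate at \<open>r = 0\<close>. Only the derivative in the one
  direction \<open>e\<close> enters. This fits the flux, each of whose components is differentiated
  in its own coordinate only.\<close>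

lemma integral_directional_derivative_eq_0:
  fixes P dP :: "'a::euclidean_space \<Rightarrow> real" and e :: 'a
  assumes cont: "continuous_on UNIV P" "continuous_on UNIV dP"
    and der: "\<And>x. ((\<lambda>r. P (x + r *\<^sub>R e)) has_real_derivative dP x) (at 0)"
    and supp: "\<And>x. R < norm x \<Longrightarrow> P x = 0" "\<And>x. R < norm x \<Longrightarrow> dP x = 0"
  shows "integral\<^sup>L lborel dP = 0"
proof -
  define U where "U = {- 1 <..< (1::real)}"
  \<comment> \<open>Translations by \<open>r *\<^sub>R e\<close> with
    \<open>\<bar>r\<bar> < 1\<close> move the support by at most \<open>norm e\<close>, so one
    enlarged radius serves all \<open>r\<close> near 0.\<close>
  have far: "R < norm (x + r *\<^sub>R e)" if "r \<in> U" "R + norm e < norm x" for r x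
  proof -
    have "norm (r *\<^sub>R e) \<le> norm e"
      using that by (auto simp: U_def intro!: mult_left_le_one_le)
    then show ?thesis
      using that norm_triangle_ineq4[of "x + r *\<^sub>R e" "r *\<^sub>R e"] by simp
  qed
  have "((\<lambda>r. integral\<^sup>L lborel (\<lambda>x. P (x + r *\<^sub>R e))) has_real_derivative
      integral\<^sup>L lborel (\<lambda>x. dP (x + 0 *\<^sub>R e))) (at 0)"
  proof (rule has_real_derivative_lborel_integral[where U = U and R = "R + norm e"
        and dh = "\<lambda>r x. dP (x + r *\<^sub>R e)"])
    fix r x
    have "((\<lambda>\<tau>. P ((x + r *\<^sub>R e) + (\<tau> - r) *\<^sub>R e)) has_real_derivative dP (x + r *\<^sub>R e) * 1) (at r)"
      by (rule DERIV_chain2[where f = "\<lambda>\<tau>. P ((x + r *\<^sub>R e) + \<tau> *\<^sub>R e)"])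
         (auto intro!: derivative_eq_intros der)
    then show "((\<lambda>\<tau>. P (x + \<tau> *\<^sub>R e)) has_real_derivative dP (x + r *\<^sub>R e)) (at r)"
      by (simp add: algebra_simps)
  next
    show "continuous_on (U \<times> UNIV) (\<lambda>(r, x). dP (x + r *\<^sub>R e))"
      unfolding case_prod_unfold
      by (intro continuous_on_compose2[OF cont(2)] continuous_intros) auto
    fix r
    show "continuous_on UNIV (\<lambda>x. P (x + r *\<^sub>R e))"
      by (intro continuous_on_compose2[OF cont(1)] continuous_intros) auto
  qed (auto simp: U_def[symmetric] far supp, auto simp: U_def)
  moreover have "integral\<^sup>L lborel (\<lambda>x. P (x + r *\<^sub>R e)) = integral\<^sup>L lborel P" for r
  proof -
    have [measurable]: "P \<in> borel_measurable borel"
      using cont(1) by (rule borel_measurable_continuous_onI)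
    show ?thesis
      by (subst (2) lborel_distr_plus[of "r *\<^sub>R e", symmetric], subst integral_distr)
         (auto simp: add.commute)
  qed
  ultimately show ?thesis
    using DERIV_unique[OF _ DERIV_const] by fastforce
qed

subsection \<open>The truncated energy\<close>

text \<open>The nonlocal coefficient is frozen as a given function \<open>b\<close> of time and
  space. This is what makes the setting symmetric: \<open>-u\<close> solves the linear equation with
  the same \<open>b\<close> and source \<open>-f\<close>, whereas the nonlocal coefficient formed
  from \<open>-u\<close> would in general be a different one. Of the diffusion only continuity in
  space and the lower bound \<open>m\<close> are kept.\<close>

locale parabolic_solution =
  fixes \<Omega> :: "(real ^ 'n) set" and T :: ereal and m R :: real
    and u ut f b :: "real \<Rightarrow> real ^ 'n \<Rightarrow> real" and Du :: "real \<Rightarrow> real ^ 'n \<Rightarrow> real ^ 'n"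
    and DF :: "'n \<Rightarrow> real \<Rightarrow> real ^ 'n \<Rightarrow> real"
  assumes open_\<Omega>: "open \<Omega>" and \<Omega>_le: "\<And>x. x \<in> \<Omega> \<Longrightarrow> norm x \<le> R" and m: "0 < m"
    and u_cont: "continuous_on ({t. 0 \<le> t \<and> ereal t < T} \<times> closure \<Omega>) (\<lambda>(t, x). u t x)"
    and u_bdry: "\<And>t x. 0 \<le> t \<Longrightarrow> ereal t < T \<Longrightarrow> x \<in> frontier \<Omega> \<Longrightarrow> u t x = 0"
    and ut_cont: "continuous_on ({t. 0 < t \<and> ereal t < T} \<times> \<Omega>) (\<lambda>(t, x). ut t x)"
    and Du_cont: "continuous_on ({t. 0 < t \<and> ereal t < T} \<times> \<Omega>) (\<lambda>(t, x). Du t x)"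
    and DF_cont: "\<And>i. continuous_on ({t. 0 < t \<and> ereal t < T} \<times> \<Omega>) (\<lambda>(t, x). DF i t x)"
    and b_cont: "\<And>t. 0 < t \<Longrightarrow> ereal t < T \<Longrightarrow> continuous_on \<Omega> (b t)"
    and b_ge: "\<And>t x. m \<le> b t x"
    and has_ut: "\<And>t x. 0 < t \<Longrightarrow> ereal t < T \<Longrightarrow> x \<in> \<Omega> \<Longrightarrow>
      ((\<lambda>\<tau>. u \<tau> x) has_real_derivative ut t x) (at t)"
    and has_Du: "\<And>t x. 0 < t \<Longrightarrow> ereal t < T \<Longrightarrow> x \<in> \<Omega> \<Longrightarrow> GDERIV (u t) x :> Du t x"
    and has_DF: "\<And>t x i. 0 < t \<Longrightarrow> ereal t < T \<Longrightarrow> x \<in> \<Omega> \<Longrightarrow>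
      ((\<lambda>r. b t (x + axis i r) * Du t (x + axis i r) $ i) has_real_derivative DF i t x) (at 0)"
    and equation: "\<And>t x. 0 < t \<Longrightarrow> ereal t < T \<Longrightarrow> x \<in> \<Omega> \<Longrightarrow>
      ut t x - (\<Sum>i\<in>UNIV. DF i t x) = f t x"
begin

section \<open>Time intervals and the zero extension of the truncation\<close>

definition Ico where "Ico = {t. 0 \<le> t \<and> ereal t < T}"
definition Ioo where "Ioo = {t. 0 < t \<and> ereal t < T}"

lemma Ioo_subset_Ico: "Ioo \<subseteq> Ico" by (auto simp: Ioo_def Ico_def)

lemma open_Ioo: "open Ioo"
proof -
  have "Ioo = {0<..} \<inter> ereal -` {..<T}" by (auto simp: Ioo_def)
  then show ?thesis by (auto intro!: open_Int open_vimage continuous_intros continuous_on_ereal)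
qed

lemma Ico_downward: "t \<in> Ico \<Longrightarrow> 0 \<le> s \<Longrightarrow> s \<le> t \<Longrightarrow> s \<in> Ico"
  unfolding Ico_def by (auto intro: le_less_trans[of "ereal s" "ereal t" T])

lemma Ioo_downward: "t \<in> Ico \<Longrightarrow> 0 < s \<Longrightarrow> s \<le> t \<Longrightarrow> s \<in> Ioo"
  using Ico_downward[of t s] by (auto simp: Ico_def Ioo_def)

lemma convex_Ioo: "convex Ioo"
proof (rule is_interval_convex)
  show "is_interval Ioo"
    unfolding is_interval_1
  proof (intro ballI allI impI)
    fix s t x assume "s \<in> Ioo" "t \<in> Ioo" "s \<le> x \<and> x \<le> t"
    then show "x \<in> Ioo" using Ioo_subset_Ico by (intro Ioo_downward[of t x]) (auto simp: Ioo_def)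
  qed
qed

definition v :: "real \<Rightarrow> real \<Rightarrow> real ^ 'n \<Rightarrow> real" where
  "v k t x = (if x \<in> \<Omega> then max 0 (u t x - k) else 0)"

lemma v_nonneg: "0 \<le> v k t x" by (simp add: v_def)

lemma v_outside: "x \<notin> \<Omega> \<Longrightarrow> v k t x = 0" by (simp add: v_def)

lemma v_far: "R < norm x \<Longrightarrow> v k t x = 0" using \<Omega>_le[of x] by (force simp: v_def)

text \<open>Gluing along two relatively closed sets, over the closure of \<open>\<Omega>\<close> and
  over its complement. They overlap over the frontier, where \<open>u = 0 < k\<close> and both
  formulas give 0.\<close>

lemma v_cont:
  assumes k: "0 < k"
  shows "continuous_on (Ico \<times> UNIV) (\<lambda>(t, x). v k t x)"
proof -
  let ?S = "Ico \<times> closure \<Omega>" and ?T = "Ico \<times> (- \<Omega>)"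
  have un: "?S \<union> ?T = Ico \<times> UNIV" using closure_subset[of \<Omega>] by auto
  have S: "?S = (Ico \<times> UNIV) \<inter> (UNIV \<times> closure \<Omega>)" and T: "?T = (Ico \<times> UNIV) \<inter> (UNIV \<times> (- \<Omega>))" by auto
  have "continuous_on (?S \<union> ?T) (\<lambda>p. if snd p \<notin> \<Omega> then 0 else max 0 (u (fst p) (snd p) - k))"
  proof (rule continuous_on_cases_local[THEN continuous_on_subset, of ?T ?S])
    show "closedin (top_of_set (?T \<union> ?S)) ?T"
      unfolding Un_commute[of ?T] un by (subst T, rule closedin_closed_Int) (auto intro!: closed_Times open_\<Omega> simp: closed_Compl)
    show "closedin (top_of_set (?T \<union> ?S)) ?S"
      unfolding Un_commute[of ?T] un by (subst S, rule closedin_closed_Int) (auto intro!: closed_Times)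
    show "continuous_on ?S (\<lambda>p. max 0 (u (fst p) (snd p) - k))"
      using u_cont by (auto intro!: continuous_intros simp: Ico_def case_prod_unfold)
    fix p assume "p \<in> ?T \<and> \<not> snd p \<notin> \<Omega> \<or> p \<in> ?S \<and> snd p \<notin> \<Omega>"
    then have "fst p \<in> Ico" "snd p \<in> frontier \<Omega>"
      using open_\<Omega> by (auto simp: frontier_def interior_open)
    then show "0 = max 0 (u (fst p) (snd p) - k)"
      using u_bdry[of "fst p" "snd p"] k by (auto simp: Ico_def)
  qed auto
  then show ?thesis
    unfolding un by (rule continuous_on_eq) (auto simp: v_def)
qed

lemma v_cont_slice: "0 < k \<Longrightarrow> t \<in> Ico \<Longrightarrow> continuous_on UNIV (v k t)"
  using continuous_on_slice[OF v_cont] .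

text \<open>Since \<open>u = 0\<close> on the boundary and \<open>k > 0\<close>, the truncation \<open>v k t\<close> vanishes near every point
  outside \<open>\<Omega>\<close>, so products with functions that are continuous in \<open>\<Omega>\<close> only are continuous
  everywhere; the junk values of these functions outside \<open>\<Omega>\<close> are multiplied by \<open>0\<close>.\<close>

lemma v_half_less: "v (k / 2) t x < k / 2 \<Longrightarrow> 0 < k \<Longrightarrow> v k t x = 0"
  by (auto simp: v_def max_def split: if_splits)

lemma v_power_mult_cont:
  assumes k: "0 < k" and j: "0 < j" and G: "continuous_on (Ioo \<times> \<Omega>) (\<lambda>(t, x). G t x)"
  shows "continuous_on (Ioo \<times> UNIV) (\<lambda>(t, x). v k t x ^ j * G t x)"
proof -
  let ?V = "\<lambda>k (p :: real \<times> (real ^ 'n)). v k (fst p) (snd p)"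
  \<comment> \<open>Truncating at the lower level \<open>k / 2\<close> yields an open set on which
    \<open>v k\<close> vanishes: \<open>v (k / 2) < k / 2\<close> forces \<open>u < k\<close> inside
    \<open>\<Omega>\<close>. It contains all points outside \<open>\<Omega>\<close>, where
    \<open>v (k / 2)\<close> is 0, so together with \<open>Ioo \<times> \<Omega>\<close> it is an
    open cover.\<close>
  define W where "W = {p \<in> Ioo \<times> UNIV. ?V (k / 2) p < k / 2}"
  have vc: "continuous_on (Ioo \<times> UNIV) (?V k)" if "0 < k" for k
    using v_cont[OF that] Ioo_subset_Ico
    by (auto simp: case_prod_unfold elim!: continuous_on_subset)
  have "open W"
  proof -
    have "W = (Ioo \<times> UNIV) \<inter> ?V (k / 2) -` {..<k / 2}" by (auto simp: W_def)
    then show ?thesis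
      using k open_Ioo by (auto intro!: continuous_open_preimage vc open_Times)
  qed
  moreover have "open (Ioo \<times> \<Omega>)" using open_Ioo open_\<Omega> by (rule open_Times)
  moreover have "continuous_on W (\<lambda>(t, x). v k t x ^ j * G t x)"
  proof (rule continuous_on_eq[where f = "\<lambda>_. 0"])
    fix p assume "p \<in> W"
    then have "?V k p = 0" using k by (intro v_half_less) (auto simp: W_def)
    then show "0 = (case p of (t, x) \<Rightarrow> v k t x ^ j * G t x)" using j by (simp add: case_prod_unfold)
  qed auto
  moreover have "continuous_on (Ioo \<times> \<Omega>) (\<lambda>(t, x). v k t x ^ j * G t x)"
    using G k unfolding case_prod_unfold
    by (intro continuous_intros continuous_on_subset[OF vc]) auto
  ultimately have "continuous_on (W \<union> Ioo \<times> \<Omega>) (\<lambda>(t, x). v k t x ^ j * G t x)"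
    by (intro continuous_on_open_Un)
  moreover have "W \<union> Ioo \<times> \<Omega> = Ioo \<times> UNIV"
    using k by (auto simp: W_def v_def)
  ultimately show ?thesis by simp
qed

lemma v_power_mult_cont_slice:
  assumes k: "0 < k" and t: "t \<in> Ioo" and j: "0 < j" and G: "continuous_on \<Omega> G"
  shows "continuous_on UNIV (\<lambda>x. v k t x ^ j * G x)"
proof -
  have "continuous_on (Ioo \<times> \<Omega>) (\<lambda>(t, x). G x)"
    unfolding case_prod_unfold by (intro continuous_on_compose2[OF G] continuous_intros) auto
  from continuous_on_slice[OF v_power_mult_cont[OF k j this] t] show ?thesis .
qed

lemma v_locally_zero:
  assumes k: "0 < k" and t: "t \<in> Ico" and x: "x \<notin> \<Omega>"
  obtains W where "open W" "x \<in> W" "\<And>y. y \<in> W \<Longrightarrow> v k t y = 0"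
proof
  show "open (v (k / 2) t -` {..<k / 2})"
    using k t by (intro open_vimage v_cont_slice) auto
  show "x \<in> v (k / 2) t -` {..<k / 2}" using k x by (simp add: v_def)
  show "v k t y = 0" if "y \<in> v (k / 2) t -` {..<k / 2}" for y
    using that k by (intro v_half_less) auto
qed

lemma v_power_has_gradient:
  assumes k: "0 < k" and t: "t \<in> Ioo"
  shows "GDERIV (\<lambda>x. v k t x ^ (j + 2)) x :> (real (j + 2) * v k t x ^ (j + 1)) *\<^sub>R Du t x"
proof (cases "x \<in> \<Omega>")
  case True
  have "(u t has_derivative (\<lambda>h. h \<bullet> Du t x)) (at x)"
    using has_Du[of t x] t True by (auto simp: Ioo_def gderiv_def)
  from has_derivative_compose[OF this has_real_derivative_pos_part_power[unfolded has_field_derivative_def]]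
  have "((\<lambda>x. max 0 (u t x - k) ^ (j + 2)) has_derivative
      (\<lambda>h. real (j + 2) * max 0 (u t x - k) ^ (j + 1) * (h \<bullet> Du t x))) (at x)" .
  then have "((\<lambda>x. v k t x ^ (j + 2)) has_derivative
      (\<lambda>h. real (j + 2) * max 0 (u t x - k) ^ (j + 1) * (h \<bullet> Du t x))) (at x)"
    by (rule has_derivative_transform_within_open[OF _ open_\<Omega> True]) (simp add: v_def)
  then show ?thesis using True by (simp add: gderiv_def v_def)
next
  case False
  obtain W where W: "open W" "x \<in> W" "\<And>y. y \<in> W \<Longrightarrow> v k t y = 0"
    using v_locally_zero[OF k _ False] t Ioo_subset_Ico by blast
  have "((\<lambda>x. v k t x ^ (j + 2)) has_derivative (\<lambda>h. 0)) (at x)"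
    by (rule has_derivative_transform_within_open[OF has_derivative_const[of 0] W(1,2)]) (simp add: W)
  then show ?thesis using False by (simp add: gderiv_def v_outside)
qed

lemma v_power_has_time_derivative:
  assumes t: "t \<in> Ioo"
  shows "((\<lambda>t. v k t x ^ (j + 2)) has_real_derivative real (j + 2) * v k t x ^ (j + 1) * ut t x) (at t)"
proof (cases "x \<in> \<Omega>")
  case True
  have "((\<lambda>\<tau>. u \<tau> x) has_real_derivative ut t x) (at t)"
    using has_ut[of t x] t True by (auto simp: Ioo_def)
  from DERIV_chain2[OF has_real_derivative_pos_part_power this]
  show ?thesis using True by (simp add: v_def)
qed (simp add: v_outside)

section \<open>Testing the equation with the cube of the truncation\<close>

lemma flux_integral:
  assumes k: "0 < k" and t: "t \<in> Ioo"
  shows "integral\<^sup>L lborel (\<lambda>x. v k t x ^ 3 * DF i t x)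
    = - 3 * integral\<^sup>L lborel (\<lambda>x. v k t x ^ 2 * (b t x * (Du t x $ i)\<^sup>2))"
proof -
  have tT: "0 < t" "ereal t < T" using t by (auto simp: Ioo_def)
  have DFc: "continuous_on \<Omega> (DF i t)"
    using continuous_on_slice[OF DF_cont, of t] tT by simp
  have Duc: "continuous_on \<Omega> (Du t)"
    using continuous_on_slice[OF Du_cont, of t] tT by simp
  note bc = b_cont[OF tT]
  let ?P = "\<lambda>x. v k t x ^ 3 * (b t x * Du t x $ i)"
  let ?A = "\<lambda>x. v k t x ^ 2 * (b t x * (Du t x $ i)\<^sup>2)"
  let ?B = "\<lambda>x. v k t x ^ 3 * DF i t x"
  have Ac: "continuous_on UNIV ?A" and Bc: "continuous_on UNIV ?B" and Pc: "continuous_on UNIV ?P"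
    by (intro v_power_mult_cont_slice k t continuous_intros bc Duc DFc; simp)+
  \<comment> \<open>Integration by parts: the integrand is the derivative of \<open>?P\<close> in
    the i-th coordinate. The product rule is applied to \<open>v ^ 3\<close> and the whole flux
    component, never to \<open>b\<close> and \<open>Du\<close> separately, as \<open>b\<close> need
    not be differentiable.\<close>
  have "integral\<^sup>L lborel (\<lambda>x. 3 * ?A x + ?B x) = 0"
  proof (rule integral_directional_derivative_eq_0[where R = R])
    show "continuous_on UNIV ?P" by (rule Pc)
    show "continuous_on UNIV (\<lambda>x. 3 * ?A x + ?B x)" by (intro continuous_intros Ac Bc)
    fix x :: "real ^ 'n"
    have ax: "r *\<^sub>R axis i 1 = (axis i r :: real ^ 'n)" for r
      by (simp add: vec_eq_iff axis_def)
    show "((\<lambda>r. ?P (x + r *\<^sub>R axis i 1)) has_real_derivative 3 * ?A x + ?B x) (at 0)"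
    proof (cases "x \<in> \<Omega>")
      case True
      have num: "1 + 2 = (3::nat)" "1 + 1 = (2::nat)" by simp_all
      have "((\<lambda>r. v k t (x + r *\<^sub>R axis i 1) ^ (1 + 2)) has_derivative
          (\<lambda>h. (h *\<^sub>R axis i 1) \<bullet> ((real (1 + 2) * v k t x ^ (1 + 1)) *\<^sub>R Du t x))) (at 0)"
        by (rule has_derivative_compose[where g = "\<lambda>x. v k t x ^ (1 + 2)"])
           (use v_power_has_gradient[OF k t, of 1 x] in \<open>auto intro!: derivative_eq_intros simp: gderiv_def\<close>)
      then have "((\<lambda>r. v k t (x + r *\<^sub>R axis i 1) ^ 3) has_derivative (\<lambda>h. h * (3 * v k t x ^ 2 * Du t x $ i))) (at 0)"
        by (simp only: num) (simp add: inner_axis' mult_ac)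
      then have 1: "((\<lambda>r. v k t (x + r *\<^sub>R axis i 1) ^ 3) has_real_derivative 3 * v k t x ^ 2 * Du t x $ i) (at 0)"
        by (simp add: has_field_derivative_def mult_commute_abs)
      have 2: "((\<lambda>r. b t (x + r *\<^sub>R axis i 1) * Du t (x + r *\<^sub>R axis i 1) $ i) has_real_derivative DF i t x) (at 0)"
        using has_DF[OF tT True] by (simp add: ax)
      from DERIV_mult[OF 1 2] show ?thesis
        by (simp add: power2_eq_square algebra_simps)
    next
      case False
      obtain W where W: "open W" "x \<in> W" "\<And>y. y \<in> W \<Longrightarrow> v k t y = 0"
        using v_locally_zero[OF k _ False] t Ioo_subset_Ico by blast
      have "open ((\<lambda>r. x + r *\<^sub>R axis i 1) -` W)"
        by (intro open_vimage W continuous_intros)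
      then have "((\<lambda>r. ?P (x + r *\<^sub>R axis i 1)) has_real_derivative 0) (at 0)"
        by (rule has_field_derivative_transform_within_open[OF DERIV_const[of 0]]) (auto simp: W)
      then show ?thesis using False by (simp add: v_outside)
    qed
  qed (auto simp: v_far)
  moreover have "integrable lborel ?A" "integrable lborel ?B"
    by (auto intro!: bounded_support_integrable[where R = R] Ac Bc simp: v_far)
  ultimately show ?thesis by simp
qed

text \<open>Read off the equation, which expresses \<open>f\<close> through the continuous functions
  \<open>ut\<close> and \<open>DF\<close>.\<close>

lemma f_cont: "continuous_on (Ioo \<times> \<Omega>) (\<lambda>(t, x). f t x)"
proof (rule continuous_on_eq)
  show "continuous_on (Ioo \<times> \<Omega>) (\<lambda>p. ut (fst p) (snd p) - (\<Sum>i\<in>UNIV. DF i (fst p) (snd p)))"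
    using ut_cont DF_cont unfolding case_prod_unfold Ioo_def by (intro continuous_intros)
qed (auto simp: Ioo_def equation)

text \<open>The squared L^2 norm of \<open>v ^ 2\<close>, the function to which the Sobolev
  inequality is applied.\<close>

definition y :: "real \<Rightarrow> real \<Rightarrow> real" where
  "y k t = integral\<^sup>L lborel (\<lambda>x. v k t x ^ 4)"

definition y' :: "real \<Rightarrow> real \<Rightarrow> real" where
  "y' k t = integral\<^sup>L lborel (\<lambda>x. 4 * (v k t x ^ 3 * ut t x))"

lemma y_cont: "0 < k \<Longrightarrow> continuous_on Ico (y k)"
  unfolding y_def using v_cont[of k]
  by (intro continuous_on_lborel_integral_param[where R = R])
     (auto simp: case_prod_unfold v_far intro!: continuous_intros)

lemma y_deriv:
  assumes k: "0 < k" and t: "t \<in> Ioo"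
  shows "(y k has_real_derivative y' k t) (at t)"
  unfolding y_def[abs_def] y'_def
proof (rule has_real_derivative_lborel_integral[OF open_Ioo convex_Ioo t, where R = R])
  fix t x assume "t \<in> Ioo"
  show "((\<lambda>t. v k t x ^ 4) has_real_derivative 4 * (v k t x ^ 3 * ut t x)) (at t)"
    using v_power_has_time_derivative[OF \<open>t \<in> Ioo\<close>, of k x 2] by (simp add: mult.assoc)
next
  have "continuous_on (Ioo \<times> UNIV) (\<lambda>(t, x). v k t x ^ 3 * ut t x)"
    using ut_cont unfolding Ioo_def[symmetric] by (intro v_power_mult_cont k) auto
  then show "continuous_on (Ioo \<times> UNIV) (\<lambda>(t, x). 4 * (v k t x ^ 3 * ut t x))"
    unfolding case_prod_unfold by (intro continuous_on_mult_left)
  show "continuous_on UNIV (\<lambda>x. v k t x ^ 4)" if "t \<in> Ioo" for t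
    using that k Ioo_subset_Ico by (intro continuous_intros v_cont_slice) auto
qed (auto simp: v_far)

text \<open>The Dirichlet integral of \<open>v ^ 2\<close>, whose gradient is
  \<open>2 v Du\<close>.\<close>

definition J :: "real \<Rightarrow> real \<Rightarrow> real" where
  "J k t = integral\<^sup>L lborel (\<lambda>x. (norm ((2 * v k t x) *\<^sub>R Du t x))\<^sup>2)"

lemma J_nn_integral:
  assumes k: "0 < k" and t: "t \<in> Ioo"
  shows "0 \<le> J k t"
    "(\<integral>\<^sup>+x. ennreal ((norm ((2 * v k t x) *\<^sub>R Du t x))\<^sup>2) \<partial>lborel) = ennreal (J k t)"
    "continuous_on UNIV (\<lambda>x. (2 * v k t x) *\<^sub>R Du t x)"
proof -
  have Duc: "continuous_on \<Omega> (Du t)"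
    using continuous_on_slice[OF Du_cont, of t] t by (simp add: Ioo_def)
  have "continuous_on UNIV (\<lambda>x. \<chi> i. 2 * (v k t x ^ 1 * Du t x $ i))"
    by (intro continuous_on_vec_lambda continuous_on_mult_left v_power_mult_cont_slice k t continuous_on_component Duc) simp
  also have "(\<lambda>x. \<chi> i. 2 * (v k t x ^ 1 * Du t x $ i)) = (\<lambda>x. (2 * v k t x) *\<^sub>R Du t x)"
    by (simp add: fun_eq_iff vec_eq_iff)
  finally show c: "continuous_on UNIV (\<lambda>x. (2 * v k t x) *\<^sub>R Du t x)" .
  have "integrable lborel (\<lambda>x. (norm ((2 * v k t x) *\<^sub>R Du t x))\<^sup>2)"
    by (rule bounded_support_integrable[where R = R], intro continuous_intros c) (simp add: v_far)
  from nn_integral_eq_integral[OF this]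
  show "(\<integral>\<^sup>+x. ennreal ((norm ((2 * v k t x) *\<^sub>R Du t x))\<^sup>2) \<partial>lborel) = ennreal (J k t)"
    by (simp add: J_def)
  show "0 \<le> J k t" by (simp add: J_def)
qed

text \<open>Differentiating the fourth power gives a factor 4 and integrating by parts against the
  cube a factor 3, so the dissipation is 12 times the integral of \<open>v ^ 2 * b\<close> times the
  squared norm of \<open>Du\<close>. As the integrand of \<open>J\<close> is
  \<open>4 * v ^ 2\<close> times that squared norm, the bound \<open>m \<le> b\<close> leaves
  \<open>3 * m * J\<close>.\<close>

lemma energy_inequality:
  assumes k: "0 < k" and t: "t \<in> Ioo"
  shows "y' k t \<le> 4 * integral\<^sup>L lborel (\<lambda>x. v k t x ^ 3 * \<bar>f t x\<bar>) - 3 * m * J k t"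
proof -
  have tT: "0 < t" "ereal t < T" using t by (auto simp: Ioo_def)
  have DFc: "continuous_on \<Omega> (DF i t)" for i
    using continuous_on_slice[OF DF_cont, of t] tT by simp
  have fc: "continuous_on \<Omega> (f t)"
    using continuous_on_slice[OF f_cont t] .
  have Duc: "continuous_on \<Omega> (Du t)"
    using continuous_on_slice[OF Du_cont, of t] tT by simp
  note bc = b_cont[OF tT]
  have intg: "integrable lborel (\<lambda>x. v k t x ^ j * G x)"
    if "continuous_on \<Omega> G" "0 < j" for j and G :: "real ^ 'n \<Rightarrow> real"
    by (rule bounded_support_integrable[where R = R], intro v_power_mult_cont_slice k t that)
       (use that in \<open>simp add: v_far\<close>)
  note i2 = intg[of _ 2, simplified] and i3 = intg[of _ 3, simplified]
  have "v k t x ^ 3 * ut t x = (\<Sum>i\<in>UNIV. v k t x ^ 3 * DF i t x) + v k t x ^ 3 * f t x" for x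
  proof (cases "x \<in> \<Omega>")
    case True
    then have "ut t x = (\<Sum>i\<in>UNIV. DF i t x) + f t x" using equation[OF tT, of x] by simp
    then show ?thesis by (simp add: distrib_left sum_distrib_left)
  qed (simp add: v_outside)
  then have "integral\<^sup>L lborel (\<lambda>x. v k t x ^ 3 * ut t x)
      = (\<Sum>i\<in>UNIV. integral\<^sup>L lborel (\<lambda>x. v k t x ^ 3 * DF i t x)) + integral\<^sup>L lborel (\<lambda>x. v k t x ^ 3 * f t x)"
    using i3[OF DFc] i3[OF fc] by simp
  also have "(\<Sum>i\<in>UNIV. integral\<^sup>L lborel (\<lambda>x. v k t x ^ 3 * DF i t x))
      = - 3 * (\<Sum>i\<in>UNIV. integral\<^sup>L lborel (\<lambda>x. v k t x ^ 2 * (b t x * (Du t x $ i)\<^sup>2)))"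
    by (simp add: flux_integral[OF k t] sum_negf sum_distrib_left)
  also have "(\<Sum>i\<in>UNIV. integral\<^sup>L lborel (\<lambda>x. v k t x ^ 2 * (b t x * (Du t x $ i)\<^sup>2)))
      = integral\<^sup>L lborel (\<lambda>x. \<Sum>i\<in>UNIV. v k t x ^ 2 * (b t x * (Du t x $ i)\<^sup>2))"
    by (rule Bochner_Integration.integral_sum[symmetric]) (intro i2 continuous_intros bc Duc)
  finally have *: "y' k t = 4 * integral\<^sup>L lborel (\<lambda>x. v k t x ^ 3 * f t x)
      - 12 * integral\<^sup>L lborel (\<lambda>x. \<Sum>i\<in>UNIV. v k t x ^ 2 * (b t x * (Du t x $ i)\<^sup>2))"
    by (simp add: y'_def)
  have "m * J k t = integral\<^sup>L lborel (\<lambda>x. m * (norm ((2 * v k t x) *\<^sub>R Du t x))\<^sup>2)"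
    by (simp add: J_def)
  also have "\<dots> \<le> integral\<^sup>L lborel (\<lambda>x. 4 * (\<Sum>i\<in>UNIV. v k t x ^ 2 * (b t x * (Du t x $ i)\<^sup>2)))"
  proof (rule integral_mono)
    show "integrable lborel (\<lambda>x. m * (norm ((2 * v k t x) *\<^sub>R Du t x))\<^sup>2)"
      by (rule bounded_support_integrable[where R = R], intro continuous_intros J_nn_integral k t) (simp add: v_far)
    show "integrable lborel (\<lambda>x. 4 * (\<Sum>i\<in>UNIV. v k t x ^ 2 * (b t x * (Du t x $ i)\<^sup>2)))"
      by (intro integrable_mult_right Bochner_Integration.integrable_sum i2 continuous_intros bc Duc)
    fix x
    have "(norm (Du t x))\<^sup>2 = (\<Sum>i\<in>UNIV. (Du t x $ i)\<^sup>2)"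
      by (simp add: norm_vec_def L2_set_def sum_nonneg)
    then have "m * (norm ((2 * v k t x) *\<^sub>R Du t x))\<^sup>2 = 4 * (v k t x ^ 2 * (\<Sum>i\<in>UNIV. m * (Du t x $ i)\<^sup>2))"
      by (simp add: power_mult_distrib sum_distrib_left[symmetric])
    also have "\<dots> \<le> 4 * (v k t x ^ 2 * (\<Sum>i\<in>UNIV. b t x * (Du t x $ i)\<^sup>2))"
      by (intro mult_left_mono sum_mono mult_right_mono b_ge) auto
    finally show "m * (norm ((2 * v k t x) *\<^sub>R Du t x))\<^sup>2 \<le> 4 * (\<Sum>i\<in>UNIV. v k t x ^ 2 * (b t x * (Du t x $ i)\<^sup>2))"
      by (simp add: sum_distrib_left)
  qed
  finally have 1: "m * J k t \<le> 4 * integral\<^sup>L lborel (\<lambda>x. \<Sum>i\<in>UNIV. v k t x ^ 2 * (b t x * (Du t x $ i)\<^sup>2))"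
    by simp
  have 2: "integral\<^sup>L lborel (\<lambda>x. v k t x ^ 3 * f t x) \<le> integral\<^sup>L lborel (\<lambda>x. v k t x ^ 3 * \<bar>f t x\<bar>)"
    by (intro integral_mono i3 continuous_intros fc mult_left_mono) (auto simp: v_nonneg)
  show ?thesis using * 1 2 by linarith
qed

section \<open>Estimates on superlevel sets and the iteration over levels\<close>

lemma v_initial: "x \<in> \<Omega> \<Longrightarrow> u 0 x \<le> k \<Longrightarrow> v k 0 x = 0" by (simp add: v_def)

lemma superlevel_eq: "0 \<le> k \<Longrightarrow> {x \<in> \<Omega>. k < u t x} = {x. 0 < v k t x}"
  by (auto simp: v_def)

lemma open_superlevel: "0 < k \<Longrightarrow> t \<in> Ico \<Longrightarrow> open {x \<in> \<Omega>. k < u t x}"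
  by (simp add: superlevel_eq open_Collect_less v_cont_slice continuous_on_const)

lemma y_le_norm:
  assumes k: "0 < k" and t: "t \<in> Ico" and s: "2 < s" and I: "0 < I" and \<mu>: "0 < \<mu>"
    and sI: "(\<integral>\<^sup>+x. ennreal (\<bar>v k t x ^ 2\<bar> powr s) \<partial>lborel) = ennreal I"
    and meas: "emeasure lborel {x \<in> \<Omega>. k < u t x} \<le> ennreal \<mu>"
  shows "y k t \<le> I powr (2 / s) * \<mu> powr (1 - 2 / s)"
proof -
  define A where "A = {x \<in> \<Omega>. k < u t x}"
  have [measurable]: "A \<in> sets borel" using open_superlevel[OF k t] by (simp add: A_def)
  have vc: "continuous_on UNIV (v k t)" using k t by (rule v_cont_slice)
  then have [measurable]: "v k t \<in> borel_measurable borel" by (rule borel_measurable_continuous_onI)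
  \<comment> \<open>Only two factors are present, so the exponent \<open>1 - 2 / s\<close> of the
    indicator is split into equal halves to fit the three-factor inequality.\<close>
  define \<gamma> where "\<gamma> = (1 - 2 / s) / 2"
  have \<gamma>: "0 < \<gamma>" using s by (simp add: \<gamma>_def)
  have pt: "v k t x ^ 4 = (\<bar>v k t x ^ 2\<bar> powr s) powr (2 / s) * indicator A x powr \<gamma> * indicator A x powr \<gamma>" for x
  proof (cases "0 < v k t x")
    case True
    then have "x \<in> A" using superlevel_eq[of k t] k by (auto simp: A_def)
    moreover have "(\<bar>v k t x ^ 2\<bar> powr s) powr (2 / s) = (v k t x ^ 2) powr 2"
      using s by (simp add: powr_powr)
    ultimately show ?thesis using True by (simp flip: power_mult)
  next
    case False
    then have "v k t x = 0" using v_nonneg[of k t x] by simp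
    then show ?thesis by simp
  qed
  have int: "integrable lborel (\<lambda>x. v k t x ^ 4)"
    by (rule bounded_support_integrable[where R = R], intro continuous_intros vc) (simp add: v_far)
  have iA: "(\<integral>\<^sup>+x. ennreal (indicator A x) \<partial>lborel) \<le> ennreal \<mu>"
    using meas by (simp add: ennreal_indicator A_def[symmetric])
  have "ennreal (y k t) = (\<integral>\<^sup>+x. ennreal (v k t x ^ 4) \<partial>lborel)"
    unfolding y_def by (rule nn_integral_eq_integral[OF int, symmetric]) simp
  also have "\<dots> \<le> ennreal (I powr (2 / s) * \<mu> powr \<gamma> * \<mu> powr \<gamma>)"
    unfolding pt using \<gamma> s I \<mu> iA sI
    by (intro Holder_nn_integral3) (auto simp: \<gamma>_def field_simps)
  also have "I powr (2 / s) * \<mu> powr \<gamma> * \<mu> powr \<gamma> = I powr (2 / s) * \<mu> powr (1 - 2 / s)"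
    by (simp add: powr_add[symmetric] \<gamma>_def mult.assoc)
  finally show ?thesis by (simp add: ennreal_le_iff)
qed

text \<open>Hoelder with exponent 1/q on \<open>f\<close> and 3/(2 s) on the s-th power of
  \<open>v ^ 2\<close>, which produces \<open>v ^ 3\<close>. The rest, 1 - 1/q - 3/(2 s) = 1/p -
  3/(2 s), falls on the indicator of the superlevel set and is positive because s > 2 p.\<close>

lemma source_term_le:
  assumes k: "0 < k" and t: "t \<in> Ioo" and pq: "1 < p" "1 < q" "1 / p + 1 / q = 1" and s: "2 * p < s"
    and I: "0 < I" and \<mu>: "0 < \<mu>" and F: "0 < F"
    and fF: "(\<integral>\<^sup>+x. ennreal (\<bar>f t x\<bar> powr q) * indicator \<Omega> x \<partial>lborel) \<le> ennreal (F powr q)"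
    and sI: "(\<integral>\<^sup>+x. ennreal (\<bar>v k t x ^ 2\<bar> powr s) \<partial>lborel) = ennreal I"
    and meas: "emeasure lborel {x \<in> \<Omega>. k < u t x} \<le> ennreal \<mu>"
  shows "integral\<^sup>L lborel (\<lambda>x. v k t x ^ 3 * \<bar>f t x\<bar>)
    \<le> F * I powr (3 / (2 * s)) * \<mu> powr (1 / p - 3 / (2 * s))"
proof -
  have t': "t \<in> Ico" using t Ioo_subset_Ico by auto
  define A where "A = {x \<in> \<Omega>. k < u t x}"
  have [measurable]: "A \<in> sets borel" using open_superlevel[OF k t'] by (simp add: A_def)
  have [measurable]: "\<Omega> \<in> sets borel" using open_\<Omega> by simp
  have vc: "continuous_on UNIV (v k t)" using k t' by (rule v_cont_slice)
  then have [measurable]: "v k t \<in> borel_measurable borel" by (rule borel_measurable_continuous_onI)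
  have fc: "continuous_on \<Omega> (f t)" using continuous_on_slice[OF f_cont t] .
  have fm: "(\<lambda>x. indicator \<Omega> x *\<^sub>R f t x) \<in> borel_measurable borel"
    by (rule borel_measurable_continuous_on_indicator[OF _ fc]) simp
  have fq: "\<bar>indicator \<Omega> x *\<^sub>R f t x\<bar> powr q = \<bar>f t x\<bar> powr q * indicator \<Omega> x" for x
    using pq by (auto split: split_indicator)
  have [measurable]: "(\<lambda>x. \<bar>f t x\<bar> powr q * indicator \<Omega> x) \<in> borel_measurable borel"
    unfolding fq[symmetric] using fm by measurable
  define \<gamma> where "\<gamma> = 1 / p - 3 / (2 * s)"
  have \<gamma>: "0 < \<gamma>" using s pq by (simp add: \<gamma>_def field_simps)
  have pt: "v k t x ^ 3 * \<bar>f t x\<bar> = (\<bar>f t x\<bar> powr q * indicator \<Omega> x) powr (1 / q)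
      * (\<bar>v k t x ^ 2\<bar> powr s) powr (3 / (2 * s)) * indicator A x powr \<gamma>" for x
  proof (cases "0 < v k t x")
    case True
    then have "x \<in> A" using superlevel_eq[of k t] k by (auto simp: A_def)
    then have "x \<in> \<Omega>" by (simp add: A_def)
    have "(\<bar>v k t x ^ 2\<bar> powr s) powr (3 / (2 * s)) = (v k t x powr 2) powr (3 / 2)"
      using s pq True by (simp add: powr_powr)
    also have "\<dots> = v k t x ^ 3"
      using True by (subst powr_powr) simp
    finally show ?thesis using True \<open>x \<in> A\<close> \<open>x \<in> \<Omega>\<close> pq by (simp add: powr_powr)
  next
    case False
    then have "v k t x = 0" using v_nonneg[of k t x] by simp
    then show ?thesis by simp
  qed
  have int: "integrable lborel (\<lambda>x. v k t x ^ 3 * \<bar>f t x\<bar>)"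
    by (rule bounded_support_integrable[where R = R], intro v_power_mult_cont_slice k t continuous_intros fc)
       (simp_all add: v_far)
  have iA: "(\<integral>\<^sup>+x. ennreal (indicator A x) \<partial>lborel) \<le> ennreal \<mu>"
    using meas by (simp add: ennreal_indicator A_def[symmetric])
  have iF: "(\<integral>\<^sup>+x. ennreal (\<bar>f t x\<bar> powr q * indicator \<Omega> x) \<partial>lborel) \<le> ennreal (F powr q)"
    using fF by (simp add: ennreal_mult ennreal_indicator)
  have "ennreal (integral\<^sup>L lborel (\<lambda>x. v k t x ^ 3 * \<bar>f t x\<bar>)) = (\<integral>\<^sup>+x. ennreal (v k t x ^ 3 * \<bar>f t x\<bar>) \<partial>lborel)"
    by (rule nn_integral_eq_integral[OF int, symmetric]) (simp add: v_nonneg)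
  also have "\<dots> \<le> ennreal ((F powr q) powr (1 / q) * I powr (3 / (2 * s)) * \<mu> powr \<gamma>)"
    unfolding pt using \<gamma> s pq I \<mu> F iA iF sI
    by (intro Holder_nn_integral3) (auto simp: \<gamma>_def)
  also have "(F powr q) powr (1 / q) = F" using F pq by (simp add: powr_powr)
  finally show ?thesis using F by (simp add: ennreal_le_iff \<gamma>_def)
qed

text \<open>Let \<open>Z ^ 2\<close> be the L^s norm of \<open>v ^ 2\<close>. The dissipation is at
  least \<open>3 * m * Z ^ 4 / K\<close> and the source at most
  \<open>4 * F * Z ^ 3 * \<mu> powr \<gamma>\<close>, so the energy cannot grow once
  \<open>Z\<close> is at least \<open>E * \<mu> powr \<gamma>\<close>. Since the energy is at most
  \<open>Z ^ 4 * \<mu> powr (1 - 2 / s)\<close>, being above the barrier forces such a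
  \<open>Z\<close>. The exponent of the barrier is \<open>4 * \<gamma> + 1 - 2 / s\<close>.\<close>

lemma truncated_energy_bound:
  assumes pq: "1 < p" "1 < q" "1 / p + 1 / q = 1" and s: "2 * p < s" and K: "0 < K"
    and Sob: "\<And>(w :: real ^ 'n \<Rightarrow> real) Dw J. (\<And>x. GDERIV w x :> Dw x) \<Longrightarrow> continuous_on UNIV Dw \<Longrightarrow>
       (\<And>x. R < norm x \<Longrightarrow> w x = 0) \<Longrightarrow> 0 \<le> J \<Longrightarrow>
       (\<integral>\<^sup>+x. ennreal ((norm (Dw x))\<^sup>2) \<partial>lborel) \<le> ennreal J \<Longrightarrow>
       \<exists>I. 0 \<le> I \<and> (\<integral>\<^sup>+x. ennreal (\<bar>w x\<bar> powr s) \<partial>lborel) = ennreal I \<and> I powr (2 / s) \<le> K * J"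
    and F: "0 < F"
    and fF: "\<And>t. t \<in> Ioo \<Longrightarrow> (\<integral>\<^sup>+x. ennreal (\<bar>f t x\<bar> powr q) * indicator \<Omega> x \<partial>lborel) \<le> ennreal (F powr q)"
    and k: "0 < k" and init: "\<And>x. x \<in> \<Omega> \<Longrightarrow> u 0 x \<le> k" and \<mu>: "0 < \<mu>"
    and meas: "\<And>t. t \<in> Ico \<Longrightarrow> emeasure lborel {x \<in> \<Omega>. k < u t x} \<le> ennreal \<mu>"
    and t: "t \<in> Ico"
  shows "y k t \<le> (4 * F * K / (3 * m)) ^ 4 * \<mu> powr (1 + (4 / p - 8 / s))"
proof (rule barrier[where y = "y k" and t = t and y' = "y' k"])
  define E where "E = 4 * F * K / (3 * m)"
  have E: "0 < E" using F K m by (simp add: E_def)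
  define \<gamma> where "\<gamma> = 1 / p - 3 / (2 * s)"
  show "0 \<le> t" using t by (simp add: Ico_def)
  show "continuous_on {0..t} (y k)"
    by (rule continuous_on_subset[OF y_cont[OF k]]) (use t Ico_downward in auto)
  have "v k 0 x = 0" for x using v_initial[OF _ init] v_outside by (cases "x \<in> \<Omega>") auto
  then show "y k 0 \<le> (4 * F * K / (3 * m)) ^ 4 * \<mu> powr (1 + (4 / p - 8 / s))"
    by (simp add: y_def)
  fix r assume r0: "0 < r" "r < t"
  then have r: "r \<in> Ioo" using Ioo_downward[OF t] by simp
  then have r': "r \<in> Ico" using Ioo_subset_Ico by auto
  show "(y k has_real_derivative y' k r) (at r)" by (rule y_deriv[OF k r])
  assume "(4 * F * K / (3 * m)) ^ 4 * \<mu> powr (1 + (4 / p - 8 / s)) < y k r"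
  then have big: "E ^ 4 * \<mu> powr (1 + (4 / p - 8 / s)) < y k r" by (simp add: E_def)
  have "\<exists>I. 0 \<le> I \<and> (\<integral>\<^sup>+x. ennreal (\<bar>v k r x ^ 2\<bar> powr s) \<partial>lborel) = ennreal I \<and> I powr (2 / s) \<le> K * J k r"
  proof (rule Sob)
    show "GDERIV (\<lambda>x. v k r x ^ 2) x :> (2 * v k r x) *\<^sub>R Du r x" for x
      using v_power_has_gradient[OF k r, of 0 x, unfolded add_0] by simp
  qed (simp_all add: J_nn_integral[OF k r] v_far del: norm_scaleR)
  then obtain I where I: "0 \<le> I" "(\<integral>\<^sup>+x. ennreal (\<bar>v k r x ^ 2\<bar> powr s) \<partial>lborel) = ennreal I"
    "I powr (2 / s) \<le> K * J k r" by blast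
  \<comment> \<open>The Hoelder estimates require positive bounds. An energy above the positive
    barrier excludes that \<open>v k r\<close> vanishes almost everywhere.\<close>
  have "I \<noteq> 0"
  proof
    assume "I = 0"
    have [measurable]: "v k r \<in> borel_measurable borel"
      using v_cont_slice[OF k r'] by (rule borel_measurable_continuous_onI)
    have "AE x in lborel. ennreal (\<bar>v k r x ^ 2\<bar> powr s) = 0"
      using I(2) \<open>I = 0\<close> by (subst nn_integral_0_iff_AE[symmetric]) auto
    then have "AE x in lborel. v k r x ^ 4 = 0"
      by eventually_elim (simp add: ennreal_eq_0_iff)
    then have "y k r = 0" unfolding y_def by (rule integral_eq_zero_AE)
    moreover have "0 < E ^ 4 * \<mu> powr (1 + (4 / p - 8 / s))" using E \<mu> by simp
    ultimately show False using big by linarith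
  qed
  then have Ipos: "0 < I" using I by simp
  define Z where "Z = I powr (1 / (2 * s))"
  have Z: "0 < Z" using Ipos by (simp add: Z_def)
  have Z4: "I powr (2 / s) = Z ^ 4" and Z3: "I powr (3 / (2 * s)) = Z ^ 3"
    using Z by (simp_all add: Z_def powr_powr powr_realpow[symmetric])
  have \<mu>4: "\<mu> powr (1 + (4 / p - 8 / s)) = (\<mu> powr \<gamma>) ^ 4 * \<mu> powr (1 - 2 / s)"
  proof -
    have e: "1 + (4 / p - 8 / s) = \<gamma> * 4 + (1 - 2 / s)" by (simp add: \<gamma>_def algebra_simps)
    show ?thesis unfolding e using \<mu> by (simp add: powr_add powr_powr powr_realpow[symmetric])
  qed
  have "y k r \<le> Z ^ 4 * \<mu> powr (1 - 2 / s)"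
    using y_le_norm[OF k r' _ Ipos \<mu> I(2) meas[OF r']] s pq by (simp add: Z4)
  with big have "(E * \<mu> powr \<gamma>) ^ 4 * \<mu> powr (1 - 2 / s) < Z ^ 4 * \<mu> powr (1 - 2 / s)"
    by (simp add: \<mu>4 power_mult_distrib)
  then have "(E * \<mu> powr \<gamma>) ^ 4 < Z ^ 4" using \<mu> by (simp add: mult_less_cancel_right)
  then have "E * \<mu> powr \<gamma> < Z" using Z by (simp add: power_less_imp_less_base)
  then have "4 * F * K * \<mu> powr \<gamma> \<le> 3 * m * Z" using m by (simp add: E_def field_simps)
  then have "(4 * F * K * \<mu> powr \<gamma>) * Z ^ 3 \<le> (3 * m * Z) * Z ^ 3"
    using Z by (intro mult_right_mono) auto
  also have "\<dots> = 3 * m * Z ^ 4" by (simp add: power4_eq_xxxx power3_eq_cube)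
  also have "\<dots> \<le> 3 * m * (K * J k r)"
    using I(3) m by (simp add: Z4)
  finally have "K * (4 * (F * Z ^ 3 * \<mu> powr \<gamma>)) \<le> K * (3 * m * J k r)"
    by (simp add: mult_ac)
  then have "4 * (F * Z ^ 3 * \<mu> powr \<gamma>) \<le> 3 * m * J k r" using K by simp
  moreover have "integral\<^sup>L lborel (\<lambda>x. v k r x ^ 3 * \<bar>f r x\<bar>) \<le> F * Z ^ 3 * \<mu> powr \<gamma>"
    using source_term_le[OF k r pq s Ipos \<mu> F fF[OF r] I(2) meas[OF r']] by (simp add: Z3 \<gamma>_def)
  ultimately show "y' k r \<le> 0" using energy_inequality[OF k r] by linarith
qed

text \<open>Chebyshev's inequality: where \<open>u\<close> exceeds \<open>h\<close>, the truncation
  at \<open>k\<close> is at least \<open>h - k\<close>.\<close>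

lemma superlevel_measure_le:
  assumes k: "0 < k" and h: "k < h" and t: "t \<in> Ico"
  shows "emeasure lborel {x \<in> \<Omega>. h < u t x} \<le> ennreal (y k t / (h - k) ^ 4)"
proof -
  have vc: "continuous_on UNIV (v k t)" using k t by (rule v_cont_slice)
  have int: "integrable lborel (\<lambda>x. v k t x ^ 4)"
    by (rule bounded_support_integrable[where R = R], intro continuous_intros vc) (simp add: v_far)
  define B where "B = {x \<in> \<Omega>. h < u t x}"
  have Bm: "B \<in> sets borel" using open_superlevel[of h t] k h t by (simp add: B_def)
  have "ennreal ((h - k) ^ 4) * emeasure lborel B = (\<integral>\<^sup>+x. ennreal ((h - k) ^ 4) * indicator B x \<partial>lborel)"
    using Bm by (simp add: nn_integral_cmult)
  also have "\<dots> \<le> (\<integral>\<^sup>+x. ennreal (v k t x ^ 4) \<partial>lborel)"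
  proof (rule nn_integral_mono)
    fix x
    show "ennreal ((h - k) ^ 4) * indicator B x \<le> ennreal (v k t x ^ 4)"
      using h by (auto simp: B_def v_def indicator_def intro!: ennreal_leI power_mono)
  qed
  also have "\<dots> = ennreal (y k t)"
    unfolding y_def by (rule nn_integral_eq_integral[OF int]) simp
  finally have "ennreal (1 / (h - k) ^ 4) * (ennreal ((h - k) ^ 4) * emeasure lborel B)
      \<le> ennreal (1 / (h - k) ^ 4) * ennreal (y k t)"
    by (rule mult_left_mono) simp
  then show ?thesis
    using h by (simp add: mult.assoc[symmetric] B_def y_def flip: ennreal_mult)
qed

lemma bounded_above:
  assumes n: "3 \<le> CARD('n)" and pn: "p < real CARD('n) / (real CARD('n) - 2)"
    and pq: "1 < p" "1 < q" "1 / p + 1 / q = 1"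
    and F: "0 < F"
    and fF: "\<And>t. 0 < t \<Longrightarrow> ereal t < T \<Longrightarrow>
      (\<integral>\<^sup>+x. ennreal (\<bar>f t x\<bar> powr q) * indicator \<Omega> x \<partial>lborel) \<le> ennreal (F powr q)"
    and R: "0 \<le> R"
    and init: "\<And>x. x \<in> \<Omega> \<Longrightarrow> u 0 x \<le> k0"
  obtains C where "\<And>t x. 0 \<le> t \<Longrightarrow> ereal t < T \<Longrightarrow> x \<in> \<Omega> \<Longrightarrow> u t x \<le> C"
proof -
  define N where "N = real CARD('n)"
  have N: "3 \<le> N" using n by (simp add: N_def)
  \<comment> \<open>Here the dimensional restriction on \<open>p\<close> enters: it leaves room for
    \<open>s\<close>.\<close>
  have "2 * p < 2 * N / (N - 2)" using pn by (simp add: N_def)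
  then obtain s where s: "2 * p < s" "s < 2 * N / (N - 2)" using dense by blast
  have s2: "2 < s" using s pq by simp
  have "s * (N - 2) < 2 * N" using s N by (simp add: field_simps)
  then have "N * (1 / 2 - 1 / s) < 1" using s2 by (simp add: field_simps)
  then have \<kappa>: "DIM(real ^ 'n) * (1 / 2 - 1 / s) < 1" by (simp add: N_def)
  obtain K where K: "0 < K" and Sob: "\<And>(w :: real ^ 'n \<Rightarrow> real) Dw J. (\<And>x. GDERIV w x :> Dw x) \<Longrightarrow> continuous_on UNIV Dw \<Longrightarrow>
       (\<And>x. R < norm x \<Longrightarrow> w x = 0) \<Longrightarrow> 0 \<le> J \<Longrightarrow>
       (\<integral>\<^sup>+x. ennreal ((norm (Dw x))\<^sup>2) \<partial>lborel) \<le> ennreal J \<Longrightarrow>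
       \<exists>I. 0 \<le> I \<and> (\<integral>\<^sup>+x. ennreal (\<bar>w x\<bar> powr s) \<partial>lborel) = ennreal I \<and> I powr (2 / s) \<le> K * J"
    using Sobolev[OF s2 \<kappa> R] by blast
  define \<delta> where "\<delta> = 4 / p - 8 / s"
  have \<delta>: "0 < \<delta>" using s pq by (simp add: \<delta>_def field_simps)
  define C where "C = (4 * F * K / (3 * m)) ^ 4"
  have C: "0 < C" using F K m by (simp add: C_def)
  \<comment> \<open>Levels must dominate the initial values, so that the energy starts at 0, and
    must be positive, so that the zero extension is continuous.\<close>
  define k1 where "k1 = max 1 k0"
  have k1: "0 < k1" "k0 \<le> k1" by (auto simp: k1_def)
  \<comment> \<open>The measure bound is required at all times at once, because the energy bound at
    one time uses it at all earlier ones.\<close>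
  define \<Phi> where "\<Phi> k \<mu> \<longleftrightarrow> (\<forall>t\<in>Ico. emeasure lborel {x \<in> \<Omega>. k < u t x} \<le> ennreal \<mu>)" for k \<mu>
  have "bounded \<Omega>" using \<Omega>_le by (auto simp: bounded_iff)
  then have fin: "emeasure lborel \<Omega> < \<infinity>" by (rule emeasure_bounded_finite)
  \<comment> \<open>The summand 1 keeps the starting mass positive even for empty
    \<open>\<Omega>\<close>.\<close>
  define \<mu> where "\<mu> = measure lborel \<Omega> + 1"
  have \<mu>: "0 < \<mu>" by (simp add: \<mu>_def add_nonneg_pos)
  have start: "\<Phi> k1 \<mu>"
    unfolding \<Phi>_def
  proof
    fix t
    have "emeasure lborel {x \<in> \<Omega>. k1 < u t x} \<le> emeasure lborel \<Omega>"
      using open_\<Omega> by (intro emeasure_mono) auto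
    also have "\<dots> = ennreal (measure lborel \<Omega>)"
      using fin by (intro emeasure_eq_ennreal_measure) auto
    also have "\<dots> \<le> ennreal \<mu>" by (intro ennreal_leI) (simp add: \<mu>_def)
    finally show "emeasure lborel {x \<in> \<Omega>. k1 < u t x} \<le> ennreal \<mu>" .
  qed
  obtain d where d: "0 < d" "\<And>j::nat. \<exists>k\<in>{k1..k1 + d}. \<Phi> k (\<mu> * (2 powr (- 4 / \<delta>)) ^ j)"
  proof (rule Stampacchia_iteration[where \<Phi> = \<Phi> and C = C and \<delta> = \<delta> and \<mu> = \<mu> and ?k0.0 = k1])
    fix k h \<nu> :: real assume kh: "k1 \<le> k" "k < h" and \<nu>: "0 < \<nu>" "\<Phi> k \<nu>"
    show "\<Phi> h (C * \<nu> powr (1 + \<delta>) / (h - k) ^ 4)"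
      unfolding \<Phi>_def
    proof
      fix t assume t: "t \<in> Ico"
      have k: "0 < k" using kh k1 by linarith
      have "y k t \<le> C * \<nu> powr (1 + \<delta>)"
        unfolding C_def \<delta>_def
      proof (rule truncated_energy_bound[OF pq s(1) K _ F _ k _ \<nu>(1) _ t])
        show "u 0 x \<le> k" if "x \<in> \<Omega>" for x using init[OF that] kh k1 by linarith
        fix w :: "real ^ 'n \<Rightarrow> real" and Dw J
        assume "\<And>x. GDERIV w x :> Dw x" "continuous_on UNIV Dw" "\<And>x. R < norm x \<Longrightarrow> w x = 0" "0 \<le> J"
          "(\<integral>\<^sup>+x. ennreal ((norm (Dw x))\<^sup>2) \<partial>lborel) \<le> ennreal J"
        then show "\<exists>I. 0 \<le> I \<and> (\<integral>\<^sup>+x. ennreal (\<bar>w x\<bar> powr s) \<partial>lborel) = ennreal I \<and> I powr (2 / s) \<le> K * J"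
          by (rule Sob)
      qed (use fF \<nu>(2) in \<open>auto simp: Ioo_def \<Phi>_def\<close>)
      then have "y k t / (h - k) ^ 4 \<le> C * \<nu> powr (1 + \<delta>) / (h - k) ^ 4"
        using kh by (intro divide_right_mono) auto
      with superlevel_measure_le[OF k kh(2) t]
      show "emeasure lborel {x \<in> \<Omega>. h < u t x} \<le> ennreal (C * \<nu> powr (1 + \<delta>) / (h - k) ^ 4)"
        by (meson ennreal_leI order_trans)
    qed
  next
    fix k \<nu> \<nu>' :: real assume "\<Phi> k \<nu>" "\<nu> \<le> \<nu>'"
    then show "\<Phi> k \<nu>'" unfolding \<Phi>_def by (meson ennreal_leI order_trans)
  qed (use C \<delta> \<mu> start in auto)
  show thesis
  proof (rule that[of "k1 + d"])
    fix t x assume tT: "0 \<le> t" "ereal t < T" and x: "x \<in> \<Omega>"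
    then have t: "t \<in> Ico" by (simp add: Ico_def)
    define B where "B = {x \<in> \<Omega>. k1 + d < u t x}"
    have "open B" unfolding B_def using k1 d t by (intro open_superlevel) auto
    define l where "l = 2 powr (- 4 / \<delta>)"
    have l: "0 < l" "l < 1" using \<delta> by (auto simp: l_def powr_less_one)
    have "emeasure lborel B \<le> ennreal (\<mu> * l ^ j)" for j
    proof -
      obtain k where k: "k1 \<le> k" "k \<le> k1 + d" "\<Phi> k (\<mu> * l ^ j)" using d(2)[of j] by (auto simp: l_def)
      have "0 < k" using k k1 by linarith
      then have "emeasure lborel B \<le> emeasure lborel {x \<in> \<Omega>. k < u t x}"
        using k open_superlevel[of k t] t by (intro emeasure_mono) (auto simp: B_def)
      also have "\<dots> \<le> ennreal (\<mu> * l ^ j)" using k t by (auto simp: \<Phi>_def)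
      finally show ?thesis .
    qed
    moreover have "(\<lambda>j. ennreal (\<mu> * l ^ j)) \<longlonglongrightarrow> ennreal (\<mu> * 0)"
      using l by (intro tendsto_ennrealI tendsto_intros LIMSEQ_realpow_zero) auto
    ultimately have "emeasure lborel B \<le> 0"
      by (intro LIMSEQ_le_const[of "\<lambda>j. ennreal (\<mu> * l ^ j)"]) auto
    \<comment> \<open>By continuity of \<open>u\<close> the superlevel set is open, so measure zero
      means empty and the bound holds at every point.\<close>
    then have "B = {}"
      using open_not_negligible[OF \<open>open B\<close>] \<open>open B\<close>
      by (auto simp: negligible_iff_null_sets null_sets_def)
    then show "u t x \<le> k1 + d" using x by (auto simp: B_def not_less[symmetric])
  qed
qed

end

subsection \<open>The nonlocal coefficient and the source term\<close>

text \<open>On a set of finite measure square integrability gives integrability, here through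
  \<open>\<bar>g x\<bar> \<le> 1 + (g x)\<^sup>2\<close>; the factor \<open>v\<close> is bounded by
  compactness of the closure.\<close>

lemma Lspace2_integrable:
  fixes g v :: "'a::euclidean_space \<Rightarrow> real"
  assumes \<Omega>: "open \<Omega>" "bounded \<Omega>" and g: "g \<in> Lspace 2 \<Omega>"
    and v: "continuous_on (closure \<Omega>) v"
  shows "integrable lebesgue (\<lambda>y. indicator \<Omega> y * (g y * v y))"
proof -
  have \<Omega>s: "\<Omega> \<in> sets lebesgue" using \<Omega> by simp
  have gm: "g \<in> borel_measurable (lebesgue_on \<Omega>)" using g by (simp add: Lspace_def)
  have fin: "(\<integral>\<^sup>+x. ennreal (\<bar>g x\<bar> powr 2) \<partial>lebesgue_on \<Omega>) < \<infinity>"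
    using g by (auto simp: Lspace_def Lnorm_def Let_def less_top split: if_splits)
  have emf: "emeasure lebesgue \<Omega> < \<infinity>"
    using emeasure_bounded_finite[OF \<Omega>(2)] \<Omega> by simp
  have "compact (v ` closure \<Omega>)"
    using v \<Omega> by (intro compact_continuous_image) (simp_all add: compact_closure)
  then obtain B where "0 < B" "\<forall>x\<in>closure \<Omega>. \<bar>v x\<bar> \<le> B"
    by (auto simp: bounded_pos dest!: compact_imp_bounded)
  then have B: "0 < B" "\<And>x. x \<in> \<Omega> \<Longrightarrow> \<bar>v x\<bar> \<le> B"
    using closure_subset[of \<Omega>] by blast+
  have vm: "v \<in> borel_measurable (lebesgue_on \<Omega>)"
    using continuous_on_subset[OF v closure_subset] \<Omega>s
    by (rule continuous_imp_measurable_on_sets_lebesgue)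
  have "integrable (lebesgue_on \<Omega>) (\<lambda>x. g x * v x)"
  proof (rule Bochner_Integration.integrable_bound)
    have "integrable (lebesgue_on \<Omega>) (\<lambda>x. (g x)\<^sup>2)"
      using gm fin by (intro integrableI_bounded) (auto simp: powr_numeral)
    moreover have "integrable (lebesgue_on \<Omega>) (\<lambda>x. 1 :: real)"
      using \<Omega>s emf by (intro integrableI_bounded) (auto simp: emeasure_restrict_space space_restrict_space)
    ultimately show "integrable (lebesgue_on \<Omega>) (\<lambda>x. B * (1 + (g x)\<^sup>2))"
      by (intro integrable_mult_right Bochner_Integration.integrable_add)
    show "(\<lambda>x. g x * v x) \<in> borel_measurable (lebesgue_on \<Omega>)" using gm vm by measurable
    show "AE x in lebesgue_on \<Omega>. norm (g x * v x) \<le> norm (B * (1 + (g x)\<^sup>2))"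
    proof (rule AE_I2)
      fix x assume "x \<in> space (lebesgue_on \<Omega>)"
      then have "x \<in> \<Omega>" by simp
      have "0 \<le> (\<bar>g x\<bar> - 1)\<^sup>2" by simp
      then have "2 * \<bar>g x\<bar> \<le> 1 + \<bar>g x\<bar>\<^sup>2" by (simp add: power2_diff)
      then have "\<bar>g x\<bar> \<le> 1 + (g x)\<^sup>2" by simp
      then have "\<bar>v x\<bar> * \<bar>g x\<bar> \<le> B * (1 + (g x)\<^sup>2)"
        using B \<open>x \<in> \<Omega>\<close> by (intro mult_mono) auto
      then show "norm (g x * v x) \<le> norm (B * (1 + (g x)\<^sup>2))"
        using B by (simp add: abs_mult mult.commute)
    qed
  qed
  then show ?thesis
    using \<Omega>s by (simp add: integrable_restrict_space)
qed

lemma continuous_on_nonlocal: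
  fixes g v :: "'a::euclidean_space \<Rightarrow> real"
  assumes \<Omega>: "open \<Omega>" "bounded \<Omega>" and g: "g \<in> Lspace 2 \<Omega>"
    and v: "continuous_on (closure \<Omega>) v"
  shows "continuous_on UNIV (nonlocal \<Omega> \<rho> g v)"
proof -
  let ?h = "\<lambda>y. indicator \<Omega> y * (g y * v y)"
  let ?i = "\<lambda>x y. indicator (cball x \<rho>) y :: real"
  have h: "integrable lebesgue ?h" by (rule Lspace2_integrable[OF \<Omega> g v])
  then have hm: "?h \<in> borel_measurable lebesgue" by (rule borel_measurable_integrable)
  have im: "?i x \<in> borel_measurable lebesgue" for x
    by (intro borel_measurable_indicator) (rule fmeasurableD[OF lmeasurable_cball])
  have eq: "nonlocal \<Omega> \<rho> g v x = integral\<^sup>L lebesgue (\<lambda>y. ?i x y * ?h y)" for x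
    unfolding nonlocal_def set_lebesgue_integral_def
    by (intro Bochner_Integration.integral_cong) (auto simp: indicator_def)
  have "(\<lambda>n. nonlocal \<Omega> \<rho> g v (X n)) \<longlonglongrightarrow> nonlocal \<Omega> \<rho> g v x" if X: "X \<longlonglongrightarrow> x" for X x
    unfolding eq
  proof (rule integral_dominated_convergence[where w = "\<lambda>y. norm (?h y)"])
    show "(\<lambda>y. ?i x y * ?h y) \<in> borel_measurable lebesgue"
      by (intro borel_measurable_times im hm)
    show "(\<lambda>y. ?i (X n) y * ?h y) \<in> borel_measurable lebesgue" for n
      by (intro borel_measurable_times im hm)
    show "integrable lebesgue (\<lambda>y. norm (?h y))" using h by (rule integrable_norm)
    show "AE y in lebesgue. norm (?i (X n) y * ?h y) \<le> norm (?h y)" for n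
      by (rule AE_I2) (auto simp: indicator_def)
    have "AE y in lebesgue. y \<notin> sphere x \<rho>"
      using negligible_sphere[of x \<rho>] by (intro AE_not_in) (simp flip: negligible_iff_null_sets)
    then show "AE y in lebesgue. (\<lambda>n. ?i (X n) y * ?h y) \<longlonglongrightarrow> ?i x y * ?h y"
    proof eventually_elim
      fix y assume y: "y \<notin> sphere x \<rho>"
      have d: "(\<lambda>n. dist (X n) y) \<longlonglongrightarrow> dist x y"
        by (intro tendsto_dist X tendsto_const)
      have "\<forall>\<^sub>F n in sequentially. ?i (X n) y = ?i x y"
      proof (cases "dist x y < \<rho>")
        case True
        from order_tendstoD(2)[OF d this] show ?thesis
          by eventually_elim (use True in \<open>auto simp: indicator_def\<close>)
      next
        case False
        then have "\<rho> < dist x y" using y by (simp add: sphere_def)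
        from order_tendstoD(1)[OF d this] show ?thesis
          by eventually_elim (use \<open>\<rho> < dist x y\<close> in \<open>auto simp: indicator_def\<close>)
      qed
      then have "\<forall>\<^sub>F n in sequentially. ?i (X n) y * ?h y = ?i x y * ?h y"
        by eventually_elim simp
      then show "(\<lambda>n. ?i (X n) y * ?h y) \<longlonglongrightarrow> ?i x y * ?h y"
        by (rule tendsto_eventually)
    qed
  qed
  then show ?thesis
    by (auto simp: continuous_on_sequentially o_def)
qed

text \<open>By the equation, \<open>f\<close> is continuous in \<open>t\<close>; Fatou's lemma therefore upgrades the almost
  everywhere bound in time to a bound at every time.\<close>

lemma Linf_Lspace_pointwise_bound:
  fixes f :: "real \<Rightarrow> 'a::euclidean_space \<Rightarrow> real"
  assumes \<Omega>: "open \<Omega>" and q: "1 < q" and f: "f \<in> Linf_Lspace (ennreal q) \<Omega>"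
    and U: "open U" "U \<subseteq> {0<..}" and cont: "continuous_on (U \<times> \<Omega>) (\<lambda>(t, x). f t x)"
  obtains F where "0 < F"
    "\<And>t. t \<in> U \<Longrightarrow> (\<integral>\<^sup>+x. ennreal (\<bar>f t x\<bar> powr q) * indicator \<Omega> x \<partial>lborel) \<le> ennreal (F powr q)"
proof -
  define H where "H t = (\<integral>\<^sup>+x. ennreal (\<bar>f t x\<bar> powr q) * indicator \<Omega> x \<partial>lborel)" for t
  have \<Omega>m: "\<Omega> \<in> sets borel" using \<Omega> by simp
  define F0 where "F0 = esssup (lebesgue_on {0<..}) (\<lambda>t. Lnorm (ennreal q) \<Omega> (f t))"
  have "F0 < \<infinity>" using f by (simp add: Linf_Lspace_def F0_def)
  \<comment> \<open>Adding 1 makes the bound positive, as the Hoelder estimates require.\<close>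
  define F where "F = enn2real F0 + 1"
  have F: "0 < F" by (simp add: F_def add_nonneg_pos)
  have F0F: "F0 \<le> ennreal F"
    using \<open>F0 < \<infinity>\<close> by (simp add: F_def ennreal_enn2real_if less_top[symmetric] flip: ennreal_1)
  have fm: "(\<lambda>x. indicator \<Omega> x *\<^sub>R f t x) \<in> borel_measurable borel" if "t \<in> U" for t
    using continuous_on_slice[OF cont that] \<Omega>m by (intro borel_measurable_continuous_on_indicator)
  have fq: "ennreal (\<bar>f t x\<bar> powr q) * indicator \<Omega> x = ennreal (\<bar>indicator \<Omega> x *\<^sub>R f t x\<bar> powr q)" for t x
    using q by (auto split: split_indicator)
  have hm: "(\<lambda>x. ennreal (\<bar>f t x\<bar> powr q) * indicator \<Omega> x) \<in> borel_measurable borel" if "t \<in> U" for t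
    unfolding fq using fm[OF that] by measurable
  have Heq: "H t = (\<integral>\<^sup>+x. ennreal (\<bar>f t x\<bar> powr q) \<partial>lebesgue_on \<Omega>)" if "t \<in> U" for t
    using \<Omega> hm[OF that] by (simp add: H_def nn_integral_restrict_space nn_integral_completion)
  have "AE t in lebesgue_on {0<..}. Lnorm (ennreal q) \<Omega> (f t) \<le> F0"
    unfolding F0_def by (rule esssup_AE)
  then have "AE t in lebesgue. t \<in> {0<..} \<longrightarrow> Lnorm (ennreal q) \<Omega> (f t) \<le> F0"
    by (simp add: AE_restrict_space_iff)
  then have ae: "AE t in lebesgue. t \<in> U \<longrightarrow> H t \<le> ennreal (F powr q)"
  proof (rule AE_mp, intro AE_I2 impI)
    fix t assume *: "t \<in> {0<..} \<longrightarrow> Lnorm (ennreal q) \<Omega> (f t) \<le> F0" and t: "t \<in> U"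
    then have le: "Lnorm (ennreal q) \<Omega> (f t) \<le> ennreal F" using U F0F by force
    then have "H t \<noteq> \<infinity>"
      using Heq[OF t] q by (auto simp: Lnorm_def Let_def top_unique split: if_splits)
    then obtain h where h: "0 \<le> h" "H t = ennreal h" by (cases "H t") auto
    have "ennreal (h powr (1 / q)) \<le> ennreal F"
      using le h q Heq[OF t] by (simp add: Lnorm_def Let_def)
    then have "h powr (1 / q) \<le> F" using F by (simp add: ennreal_le_iff)
    then have "(h powr (1 / q)) powr q \<le> F powr q" using q by (intro powr_mono2) auto
    then show "H t \<le> ennreal (F powr q)"
      using h q by (auto simp: powr_powr intro: ennreal_leI)
  qed
  show thesis
  proof (rule that[OF F])
    fix t assume t: "t \<in> U"
    \<comment> \<open>Good times are dense in \<open>U\<close>: otherwise a nonempty open set of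
      times would be negligible.\<close>
    have "\<exists>s. s \<in> U \<and> dist s t < e \<and> H s \<le> ennreal (F powr q)" if "0 < e" for e
    proof (rule ccontr)
      assume neg: "\<not> ?thesis"
      have "AE s in lebesgue. s \<notin> U \<inter> ball t e"
        using ae by eventually_elim (use neg in \<open>auto simp: dist_commute\<close>)
      then have "U \<inter> ball t e \<in> null_sets lebesgue"
        using U by (subst (asm) AE_iff_null_sets[symmetric]) auto
      then have "negligible (U \<inter> ball t e)" by (simp add: negligible_iff_null_sets)
      moreover have "open (U \<inter> ball t e)" "t \<in> U \<inter> ball t e" using U t that by auto
      ultimately show False using open_not_negligible by blast
    qed
    then have "\<exists>s. s \<in> U \<and> dist s t < inverse (real (Suc n)) \<and> H s \<le> ennreal (F powr q)" for n
      by simp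
    then obtain S where S: "\<And>n. S n \<in> U" "\<And>n. dist (S n) t < inverse (real (Suc n))"
      "\<And>n. H (S n) \<le> ennreal (F powr q)" by metis
    have "S \<longlonglongrightarrow> t"
    proof (rule tendsto_dist_iff[THEN iffD2], rule tendsto_sandwich[OF _ _ tendsto_const LIMSEQ_inverse_real_of_nat])
      show "\<forall>\<^sub>F n in sequentially. dist (S n) t \<le> inverse (real (Suc n))"
        by (intro always_eventually allI less_imp_le S(2))
    qed simp
    have lim: "(\<lambda>n. ennreal (\<bar>f (S n) x\<bar> powr q) * indicator \<Omega> x)
        \<longlonglongrightarrow> ennreal (\<bar>f t x\<bar> powr q) * indicator \<Omega> x" for x
    proof (cases "x \<in> \<Omega>")
      case True
      have "continuous_on U (\<lambda>t. f t x)"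
      proof -
        have "continuous_on U (\<lambda>t. (t, x))" by (intro continuous_intros)
        from continuous_on_compose2[OF cont this] show ?thesis using True by auto
      qed
      then have "(\<lambda>n. f (S n) x) \<longlonglongrightarrow> f t x"
        using \<open>S \<longlonglongrightarrow> t\<close> S t by (auto simp: continuous_on_sequentially o_def)
      then have "(\<lambda>n. \<bar>f (S n) x\<bar> powr q) \<longlonglongrightarrow> \<bar>f t x\<bar> powr q"
        using q by (intro tendsto_powr' tendsto_intros) auto
      then show ?thesis using True by (simp add: tendsto_ennrealI)
    qed simp
    have "H t = (\<integral>\<^sup>+x. liminf (\<lambda>n. ennreal (\<bar>f (S n) x\<bar> powr q) * indicator \<Omega> x) \<partial>lborel)"
      unfolding H_def using lim_imp_Liminf[OF _ lim] by simp
    also have "\<dots> \<le> liminf (\<lambda>n. H (S n))"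
      unfolding H_def by (rule nn_integral_liminf) (use hm S in auto)
    also have "\<dots> \<le> ennreal (F powr q)"
      by (rule Liminf_le) (use S in \<open>auto intro!: always_eventually\<close>)
    finally show "(\<integral>\<^sup>+x. ennreal (\<bar>f t x\<bar> powr q) * indicator \<Omega> x \<partial>lborel) \<le> ennreal (F powr q)"
      by (simp add: H_def)
  qed
qed

theorem theorem4p1:
  fixes \<Omega> :: "(real ^ 'n) set" and T :: ereal
    and a :: "real \<Rightarrow> real" and m M \<rho> p q :: real
    and g u0 :: "real ^ 'n \<Rightarrow> real" and f u :: "real \<Rightarrow> real ^ 'n \<Rightarrow> real"
  assumes "CARD('n) \<ge> 3"
    and "open \<Omega>" and "bounded \<Omega>"
    and "continuous_on UNIV a"
    and "0 < m" and "\<And>\<epsilon>. m \<le> a \<epsilon> \<and> a \<epsilon> \<le> M"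
    and "0 \<le> \<rho>" and "\<rho> \<le> diameter \<Omega>"
    and "g \<in> Lspace 2 \<Omega>"
    and "0 < T"
    and "classical_solution \<Omega> T a \<rho> g f u0 u"
    and "p > 1" and "q > 1" and "1 / p + 1 / q = 1"
    and "(SUP t \<in> {t. 0 \<le> t \<and> ereal t < T}. Lnorm (ennreal q) \<Omega> (u t)) < \<infinity>"
    and "f \<in> Linf_Lspace (ennreal q) \<Omega>"
    and "p < real CARD('n) / (real CARD('n) - 2)"
  shows "(SUP t \<in> {t. 0 \<le> t \<and> ereal t < T}. Lnorm \<infinity> \<Omega> (u t)) < \<infinity>"
proof -
  let ?Ioo = "{t. 0 < t \<and> ereal t < T}"
  obtain ut Du DF where
    u_cont: "continuous_on ({t. 0 \<le> t \<and> ereal t < T} \<times> closure \<Omega>) (\<lambda>(t, x). u t x)"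
    and cont: "continuous_on (?Ioo \<times> \<Omega>) (\<lambda>(t, x). ut t x)"
      "continuous_on (?Ioo \<times> \<Omega>) (\<lambda>(t, x). Du t x)"
      "\<And>i. continuous_on (?Ioo \<times> \<Omega>) (\<lambda>(t, x). DF i t x)"
    and pde: "\<And>t x. 0 < t \<Longrightarrow> ereal t < T \<Longrightarrow> x \<in> \<Omega> \<Longrightarrow>
           ((\<lambda>\<tau>. u \<tau> x) has_real_derivative ut t x) (at t) \<and>
           GDERIV (u t) x :> Du t x \<and>
           (\<forall>i. ((\<lambda>r. let y = x + axis i r in a (nonlocal \<Omega> \<rho> g (u t) y) * Du t y $ i)
                   has_real_derivative DF i t x) (at 0)) \<and>
           ut t x - (\<Sum>i\<in>UNIV. DF i t x) = f t x"
    and bdry: "\<And>t x. 0 \<le> t \<Longrightarrow> ereal t < T \<Longrightarrow> x \<in> frontier \<Omega> \<Longrightarrow> u t x = 0"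
    using assms(11) unfolding classical_solution_def by blast
  obtain R where R: "0 < R" "\<And>x. x \<in> \<Omega> \<Longrightarrow> norm x \<le> R"
    using \<open>bounded \<Omega>\<close> by (auto simp: bounded_pos)
  have us: "continuous_on (closure \<Omega>) (u t)" if "0 \<le> t" "ereal t < T" for t
    using continuous_on_slice[OF u_cont] that by simp
  define b where "b t x = a (nonlocal \<Omega> \<rho> g (u t) x)" for t x
  have b_cont: "continuous_on \<Omega> (b t)" if "0 < t" "ereal t < T" for t
    unfolding b_def using that
    by (intro continuous_on_compose2[OF assms(4)]
          continuous_on_subset[OF continuous_on_nonlocal[OF assms(2,3,9) us]]) auto
  interpret pos: parabolic_solution \<Omega> T m R u ut f b Du DF
  proof unfold_locales
    show "m \<le> b t x" for t x using assms(6) by (simp add: b_def)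
    fix t x i assume t: "0 < t" "ereal t < T" "x \<in> \<Omega>"
    show "((\<lambda>r. b t (x + axis i r) * Du t (x + axis i r) $ i) has_real_derivative DF i t x) (at 0)"
      using pde[OF t] by (simp add: b_def Let_def)
  qed (fact assms(2,5) R(2) u_cont cont b_cont bdry | simp add: pde)+
  \<comment> \<open>The coefficient \<open>b\<close> remains the one built from \<open>u\<close>;
    only the solution, its derivatives and the source change sign.\<close>
  interpret neg: parabolic_solution \<Omega> T m R "\<lambda>t x. - u t x" "\<lambda>t x. - ut t x" "\<lambda>t x. - f t x" b
    "\<lambda>t x. - Du t x" "\<lambda>i t x. - DF i t x"
  proof unfold_locales
    fix t x i assume t: "0 < t" "ereal t < T" "x \<in> \<Omega>"
    show "((\<lambda>\<tau>. - u \<tau> x) has_real_derivative - ut t x) (at t)"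
      using pos.has_ut[OF t] by (rule DERIV_minus)
    show "GDERIV (\<lambda>x. - u t x) x :> - Du t x"
      using pos.has_Du[OF t] by (rule GDERIV_minus)
    show "((\<lambda>r. b t (x + axis i r) * (- Du t (x + axis i r)) $ i) has_real_derivative - DF i t x) (at 0)"
      using DERIV_minus[OF pos.has_DF[OF t, of i]] by simp
    show "- ut t x - (\<Sum>i\<in>UNIV. - DF i t x) = - f t x"
      using pos.equation[OF t] by (simp add: sum_negf)
  next
    show "continuous_on ({t. 0 \<le> t \<and> ereal t < T} \<times> closure \<Omega>) (\<lambda>(t, x). - u t x)"
      using u_cont unfolding case_prod_unfold by (rule continuous_on_minus)
    show "continuous_on (?Ioo \<times> \<Omega>) (\<lambda>(t, x). - ut t x)"
      using cont(1) unfolding case_prod_unfold by (rule continuous_on_minus)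
    show "continuous_on (?Ioo \<times> \<Omega>) (\<lambda>(t, x). - Du t x)"
      using cont(2) unfolding case_prod_unfold by (rule continuous_on_minus)
    show "continuous_on (?Ioo \<times> \<Omega>) (\<lambda>(t, x). - DF i t x)" for i
      using cont(3)[of i] unfolding case_prod_unfold by (rule continuous_on_minus)
    show "- u t x = 0" if "0 \<le> t" "ereal t < T" "x \<in> frontier \<Omega>" for t x
      using bdry[OF that] by simp
  qed (fact assms(2,5) R(2) b_cont pos.b_ge)+
  obtain F where F: "0 < F" "\<And>t. t \<in> ?Ioo \<Longrightarrow>
      (\<integral>\<^sup>+x. ennreal (\<bar>f t x\<bar> powr q) * indicator \<Omega> x \<partial>lborel) \<le> ennreal (F powr q)"
    by (rule Linf_Lspace_pointwise_bound[OF assms(2,13,16) pos.open_Ioo _ pos.f_cont])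
       (auto simp: pos.Ioo_def)
  have "compact (u 0 ` closure \<Omega>)"
    using us[of 0] assms(3,10)
    by (intro compact_continuous_image) (simp_all add: compact_closure zero_ereal_def)
  then obtain k0 where "\<forall>x\<in>closure \<Omega>. \<bar>u 0 x\<bar> \<le> k0"
    by (auto simp: bounded_pos dest!: compact_imp_bounded)
  then have k0: "\<And>x. x \<in> \<Omega> \<Longrightarrow> \<bar>u 0 x\<bar> \<le> k0"
    using closure_subset[of \<Omega>] by blast
  obtain C1 where C1: "\<And>t x. 0 \<le> t \<Longrightarrow> ereal t < T \<Longrightarrow> x \<in> \<Omega> \<Longrightarrow> u t x \<le> C1"
    by (rule pos.bounded_above[OF assms(1,17,12,13,14) F(1), of k0])
       (use F R k0 in \<open>auto simp: abs_le_iff\<close>)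
  obtain C2 where C2: "\<And>t x. 0 \<le> t \<Longrightarrow> ereal t < T \<Longrightarrow> x \<in> \<Omega> \<Longrightarrow> - u t x \<le> C2"
    \<comment> \<open>The same \<open>F\<close> and \<open>k0\<close> serve both signs, since they
      bound absolute values of \<open>f\<close> and of the initial values.\<close>
    by (rule neg.bounded_above[OF assms(1,17,12,13,14) F(1), of k0])
       (use F R k0 in \<open>auto simp: abs_le_iff\<close>)
  have "Lnorm \<infinity> \<Omega> (u t) \<le> ennreal (max C1 C2)" if t: "0 \<le> t" "ereal t < T" for t
  proof -
    \<comment> \<open>Measurability is essential here: \<open>esssup\<close> takes the value
      \<open>top\<close> on nonmeasurable functions.\<close>
    have "u t \<in> borel_measurable (lebesgue_on \<Omega>)"
      using continuous_on_subset[OF us[OF t] closure_subset] assms(2)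
      by (intro continuous_imp_measurable_on_sets_lebesgue) auto
    then have "esssup (lebesgue_on \<Omega>) (\<lambda>x. ennreal \<bar>u t x\<bar>) \<le> ennreal (max C1 C2)"
    proof (intro esssup_I AE_I2)
      fix x assume "x \<in> space (lebesgue_on \<Omega>)"
      then have "u t x \<le> C1" "- u t x \<le> C2" using C1[OF t] C2[OF t] by auto
      then show "ennreal \<bar>u t x\<bar> \<le> ennreal (max C1 C2)" by (intro ennreal_leI) auto
    qed measurable
    then show ?thesis by (simp add: Lnorm_def)
  qed
  then have "(SUP t \<in> {t. 0 \<le> t \<and> ereal t < T}. Lnorm \<infinity> \<Omega> (u t)) \<le> ennreal (max C1 C2)"
    by (intro SUP_least) auto
  then show ?thesis by (rule le_less_trans) simp
qed

end
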